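(* Let $p,q$ be coprime with $2\le p<q$, $r=pq-p-q$, and let $h=\operatorname{diag}(e^{2\pi i p/r},e^{2\pi i q/r})$, which generates a cyclic group of order $r$ acting freely on $\mathbb C^2\setminus\{0\}$. Let $\Sigma=\mathbb C^2/\langle h\rangle$ and let $W\subset\Sigma$ be the image of $V=\{c_bz_1^q+c_az_2^p=0\}$. Let $T'\mathbb H^2$ be the tangent bundle of $\mathbb H^2$ minus the zero section, with $\Gamma_{p,q}$ acting by differentials. Then $T'\mathbb H^2/\Gamma_{p,q}$ is biholomorphic to $\Sigma\setminus W$ by a map that is $\mathbb C^\times$-equivariant, where $\lambda\in\mathbb C^\times$ acts on $T'\mathbb H^2$ by scalar multiplication of tangent vectors and on $\Sigma$ by $[z_1,z_2]\mapsto[\mu^{p}z_1,\mu^{q}z_2]$ for any $\mu$ with $\mu^r=\lambda$ (well defined modulo $\langle h\rangle$).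
   Context: $\mathbb H^2$ is the upper half plane; $\Gamma_{p,q}\subset PSL_2(\mathbb R)$ is the $(p,q,\infty)$-triangle group generated by the classes $\alpha_0,\beta_0$ of $A_0=\begin{pmatrix}2\cos(\pi/p)&1\\-1&0\end{pmatrix}$ and $B_0=\begin{pmatrix}0&1\\-1&2\cos(\pi/q)\end{pmatrix}$. The constants $c_a,c_b$ are the nonzero complex numbers such that $\omega_\infty=c_a\omega_a^p+c_b\omega_b^q$, where $\omega_a,\omega_b,\omega_\infty$ are defined as follows. Let $\theta\colon\mathbb H^2\to\mathbb C$ be a holomorphic $\Gamma_{p,q}$-invariant function inducing a bijection $\mathbb H^2/\Gamma_{p,q}\to\mathbb C$ with $\theta(a)=0,\theta(b)=1$, where $a=-\cos(\pi/p)+i\sin(\pi/p)$, $b=\cos(\pi/q)+i\sin(\pi/q)$ are the fixed points of $\alpha_0,\beta_0$. Let $f_a,f_b,f_\infty$ be holomorphic branches of the $r$-th roots of $(\theta')^q/(\theta(\theta-1)^{q-1})$, $(\theta')^p/(\theta^{p-1}(\theta-1))$, $(\theta')^{pq}/(\theta^{(p-1)q}(\theta-1)^{p(q-1)})$, and (viewing a degree-$k$ form $f\,dz^k$ as the function $(z,w)\mapsto f(z)\overline{w^k}$ on $\mathbb H^2\times\widetilde{\mathbb C^\times}$, with $\widetilde{\mathbb C^\times}$ the universal cover of $\mathbb C^\times$, $(e^u)^k=e^{ku}$, bar denoting projection to $\mathbb C^\times$) $\omega_a=f_adz^{q/r}$, $\omega_b=f_bdz^{p/r}$, $\omega_\infty=f_\infty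 dz^{pq/r}$. *)

theory Defs
  imports "HOL-Analysis.Analysis"
begin

definition H2 :: "complex set" where "H2 = {z. Im z > 0}"

text \<open>2x2 real matrices (a,b,c,d) = [[a,b],[c,d]], all of determinant 1 here.\<close>
type_synonym mat2 = "real \<times> real \<times> real \<times> real"

fun mmul :: "mat2 \<Rightarrow> mat2 \<Rightarrow> mat2" where
  "mmul (a,b,c,d) (a',b',c',d') = (a*a'+b*c', a*b'+b*d', c*a'+d*c', c*b'+d*d')"

definition A0 :: "nat \<Rightarrow> mat2" where "A0 p = (2 * cos (pi / real p), 1, -1, 0)"
definition A0inv :: "nat \<Rightarrow> mat2" where "A0inv p = (0, -1, 1, 2 * cos (pi / real p))"
definition B0 :: "nat \<Rightarrow> mat2" where "B0 q = (0, 1, -1, 2 * cos (pi / real q))"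
definition B0inv :: "nat \<Rightarrow> mat2" where "B0inv q = (2 * cos (pi / real q), -1, 1, 0)"

text \<open>Matrix representatives (in SL2(R)) of the triangle group \<Gamma>_{p,q}: the subgroup
  generated by A0, B0. Since the actions below only depend on the class in PSL2(R),
  working with SL2 representatives is harmless.\<close>
inductive_set Gamma :: "nat \<Rightarrow> nat \<Rightarrow> mat2 set" for p q where
  one: "(1,0,0,1) \<in> Gamma p q"
| mA: "g \<in> Gamma p q \<Longrightarrow> mmul (A0 p) g \<in> Gamma p q"
| mAi: "g \<in> Gamma p q \<Longrightarrow> mmul (A0inv p) g \<in> Gamma p q"
| mB: "g \<in> Gamma p q \<Longrightarrow> mmul (B0 q) g \<in> Gamma p q"
| mBi: "g \<in> Gamma p q \<Longrightarrow> mmul (B0inv q) g \<in> Gamma p q"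

fun mob :: "mat2 \<Rightarrow> complex \<Rightarrow> complex" where
  "mob (a,b,c,d) z = (of_real a * z + of_real b) / (of_real c * z + of_real d)"

text \<open>Action on tangent vectors by the differential: derivative of mob is 1/(cz+d)^2.\<close>
fun dmob :: "mat2 \<Rightarrow> complex \<Rightarrow> complex" where
  "dmob (a,b,c,d) z = 1 / (of_real c * z + of_real d)^2"

text \<open>Equivalence of points of T'H^2 = H^2 \<times> C^\<times> under \<Gamma>_{p,q} acting by differentials.\<close>
definition tan_equiv :: "nat \<Rightarrow> nat \<Rightarrow> complex \<times> complex \<Rightarrow> complex \<times> complex \<Rightarrow> bool" where
  "tan_equiv p q x y \<longleftrightarrow> (\<exists>g\<in>Gamma p q. snd y = dmob g (fst x) * snd x \<and> fst y = mob g (fst x))"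

definition h_equiv :: "nat \<Rightarrow> nat \<Rightarrow> complex \<times> complex \<Rightarrow> complex \<times> complex \<Rightarrow> bool" where
  "h_equiv p q w w' \<longleftrightarrow> (let r = p*q - p - q in
     \<exists>k::nat. fst w' = exp (2 * pi * \<i> * of_nat (p*k) / of_nat r) * fst w
            \<and> snd w' = exp (2 * pi * \<i> * of_nat (q*k) / of_nat r) * snd w)"

definition loc_biholo2 :: "(complex \<times> complex \<Rightarrow> complex \<times> complex) \<Rightarrow> (complex \<times> complex) set \<Rightarrow> bool" where
  "loc_biholo2 F S \<longleftrightarrow> open S \<and> (\<forall>x\<in>S. \<exists>D. (F has_derivative D) (at x)
       \<and> (\<forall>c y. D (c * fst y, c * snd y) = (c * fst (D y), c * snd (D y)))
       \<and> bij D)"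

text \<open>A degree-k form f dz^k viewed as a function on H^2 \<times> (universal cover of C^\<times>),
  the universal cover parametrised by u \<in> C with projection exp u, so that w^k = exp(k u).\<close>
definition form :: "(complex \<Rightarrow> complex) \<Rightarrow> real \<Rightarrow> complex \<times> complex \<Rightarrow> complex" where
  "form f k = (\<lambda>(z,u). f z * exp (of_real k * u))"

end

theory Submission
  imports Defs "HOL-Complex_Analysis.Complex_Analysis"
begin

text \<open>
  The map is \<open>\<Phi> = (\<omega>\<^sub>b, \<omega>\<^sub>a)\<close>. Comparing \<open>r\<close>-th powers, \<open>c\<^sub>a f\<^sub>a\<^sup>p = \<theta> f\<^sub>\<infinity>\<close> and
  \<open>c\<^sub>b f\<^sub>b\<^sup>q = (1 - \<theta>) f\<^sub>\<infinity>\<close>, and the Jacobian of \<open>\<Phi>\<close> is, up to nonvanishing factors, a function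
  whose \<open>r\<close>-th power is \<open>f\<^sub>\<infinity>\<^sup>r\<close>. Hence everything reduces to \<open>f\<^sub>\<infinity>\<close> having no zeros: then
  \<open>\<theta> = c\<^sub>a \<omega>\<^sub>a\<^sup>p / \<omega>\<^sub>\<infinity>\<close> recovers the orbit of the base point from \<open>\<Phi>\<close>, and the tangent vector is then
  determined up to roots of unity, which coprimality of \<open>p\<close>, \<open>q\<close>, \<open>r\<close> and the stabilizers account for.

  A zero of \<open>f\<^sub>\<infinity>\<close> means that \<open>\<theta>\<close> ramifies more than the orbits of \<open>a\<close> and \<open>b\<close> allow, which would
  produce an element of \<open>\<Gamma>\<close> fixing a point with derivative a primitive \<open>n\<close>-th root of unity for a
  forbidden \<open>n\<close>. This is excluded because cyclically reduced words in \<open>A0\<close> and \<open>B0\<close> of length at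
  least two have trace of modulus at least two.
\<close>

section \<open>The triangle group\<close>

fun mdet :: "mat2 \<Rightarrow> real" where "mdet (a,b,c,d) = a * d - b * c"
fun mtr :: "mat2 \<Rightarrow> real" where "mtr (a,b,c,d) = a + d"
text \<open>The adjugate, which is the inverse because every matrix used here has determinant
  1.\<close>

fun minv :: "mat2 \<Rightarrow> mat2" where "minv (a,b,c,d) = (d, -b, -c, a)"
fun mneg :: "mat2 \<Rightarrow> mat2" where "mneg (a,b,c,d) = (-a, -b, -c, -d)"
abbreviation mone :: mat2 where "mone \<equiv> (1,0,0,1)"

lemma mmul_assoc: "mmul (mmul x y) z = mmul x (mmul y z)"
  by (cases x; cases y; cases z) (simp add: algebra_simps)

lemma mmul_one [simp]: "mmul mone x = x" "mmul x mone = x"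
  by (cases x; simp)+

lemma mdet_mmul: "mdet (mmul x y) = mdet x * mdet y"
  by (cases x; cases y) (simp add: algebra_simps)

lemma mmul_minv: "mdet x = 1 \<Longrightarrow> mmul x (minv x) = mone" "mdet x = 1 \<Longrightarrow> mmul (minv x) x = mone"
  by (cases x; simp add: algebra_simps)+

lemma minv_mmul: "minv (mmul x y) = mmul (minv y) (minv x)"
  by (cases x; cases y) (simp add: algebra_simps)

lemma mneg_mneg [simp]: "mneg (mneg x) = x"
  by (cases x) simp

lemma mneg_mmul: "mmul (mneg x) y = mneg (mmul x y)" "mmul x (mneg y) = mneg (mmul x y)"
  by (cases x; cases y; simp add: algebra_simps)+

lemma mtr_commute: "mtr (mmul x y) = mtr (mmul y x)"
  by (cases x; cases y) (simp add: algebra_simps)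

lemma mdet_gen: "mdet (A0 p) = 1" "mdet (A0inv p) = 1" "mdet (B0 q) = 1" "mdet (B0inv q) = 1"
  by (simp_all add: A0_def A0inv_def B0_def B0inv_def)

lemma mdet_Gamma: "g \<in> Gamma p q \<Longrightarrow> mdet g = 1"
  by (induction rule: Gamma.induct) (simp_all add: mdet_mmul mdet_gen)

lemma Gamma_mmul: "g \<in> Gamma p q \<Longrightarrow> h \<in> Gamma p q \<Longrightarrow> mmul g h \<in> Gamma p q"
  by (induction rule: Gamma.induct) (auto simp: mmul_assoc intro: Gamma.intros)

lemma Gamma_gen: "A0 p \<in> Gamma p q" "A0inv p \<in> Gamma p q" "B0 q \<in> Gamma p q" "B0inv q \<in> Gamma p q"
  using Gamma.mA[OF Gamma.one, of p q] Gamma.mAi[OF Gamma.one, of p q]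
    Gamma.mB[OF Gamma.one, of q p] Gamma.mBi[OF Gamma.one, of q p] by simp_all

lemma minv_gen: "minv (A0 p) = A0inv p" "minv (A0inv p) = A0 p" "minv (B0 q) = B0inv q" "minv (B0inv q) = B0 q"
  by (simp_all add: A0_def A0inv_def B0_def B0inv_def)

lemma Gamma_minv: "g \<in> Gamma p q \<Longrightarrow> minv g \<in> Gamma p q"
  by (induction rule: Gamma.induct)
    (auto simp: minv_mmul minv_gen Gamma.one intro!: Gamma_mmul Gamma_gen)

section \<open>The Moebius action and its derivative on the upper half plane\<close>

lemma mob_denom_nz:
  assumes "mdet (a,b,c,d) = 1" "z \<in> H2"
  shows "of_real c * z + of_real d \<noteq> 0"
proof
  assume e: "of_real c * z + of_real d = 0"
  have "c = 0" using arg_cong[OF e, of Im] assms(2) by (simp add: H2_def)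
  moreover have "c * Re z + d = 0" using arg_cong[OF e, of Re] by simp
  ultimately show False using assms(1) by simp
qed

lemma mob_in_H2:
  assumes "mdet g = 1" "z \<in> H2" shows "mob g z \<in> H2"
proof (cases g)
  case (fields a b c d)
  have nz: "of_real c * z + of_real d \<noteq> 0" using mob_denom_nz assms fields by metis
  have "Im (mob g z) = (a * d - b * c) * Im z / (cmod (of_real c * z + of_real d))\<^sup>2"
    using nz unfolding fields by (simp add: Im_divide cmod_power2 algebra_simps)
  also have "\<dots> > 0" using nz assms fields by (simp add: H2_def)
  finally show ?thesis by (simp add: H2_def)
qed

text \<open>The factor cz + d is a cocycle: the denominator of the composite is the product of the
  two denominators, which is \<open>e\<close>. Both claims follow by dividing out.\<close>

lemma mob_mmul:
  assumes "mdet g = 1" "mdet h = 1" "z \<in> H2"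
  shows "mob (mmul g h) z = mob g (mob h z)"
    and "dmob (mmul g h) z = dmob g (mob h z) * dmob h z"
proof -
  obtain a b c d where g: "g = (a,b,c,d)" by (cases g)
  obtain a' b' c' d' where h: "h = (a',b',c',d')" by (cases h)
  have nz: "of_real c' * z + of_real d' \<noteq> 0" using mob_denom_nz assms h by metis
  have "mob h z \<in> H2" using mob_in_H2 assms by blast
  hence nz': "of_real c * mob h z + of_real d \<noteq> 0" using mob_denom_nz assms g by metis
  have e: "of_real c * mob h z + of_real d
    = (of_real (c*a'+d*c') * z + of_real (c*b'+d*d')) / (of_real c' * z + of_real d')"
    using nz unfolding h by (simp add: field_simps)
  have e': "of_real a * mob h z + of_real b
    = (of_real (a*a'+b*c') * z + of_real (a*b'+b*d')) / (of_real c' * z + of_real d')"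
    using nz unfolding h by (simp add: field_simps)
  have n3: "of_real (c*a'+d*c') * z + of_real (c*b'+d*d') \<noteq> 0"
    using nz' unfolding e by auto
  have "mob g (mob h z) = (of_real a * mob h z + of_real b) / (of_real c * mob h z + of_real d)"
    unfolding g by simp
  also have "\<dots> = mob (mmul g h) z"
    unfolding e e' unfolding g h using nz n3 by simp
  finally show "mob (mmul g h) z = mob g (mob h z)" by simp
  have "dmob g (mob h z) = 1 / (of_real c * mob h z + of_real d)^2"
    unfolding g by simp
  also have "\<dots> * dmob h z = dmob (mmul g h) z"
    unfolding e unfolding g h using nz n3 by (simp add: power_divide)
  finally show "dmob (mmul g h) z = dmob g (mob h z) * dmob h z" by simp
qed

lemma dmob_nz: "mdet g = 1 \<Longrightarrow> z \<in> H2 \<Longrightarrow> dmob g z \<noteq> 0"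
  using mob_denom_nz by (cases g) (metis divide_eq_0_iff dmob.simps one_neq_zero power_not_zero)

lemma has_field_derivative_mob:
  assumes "mdet g = 1" "z \<in> H2"
  shows "(mob g has_field_derivative dmob g z) (at z)"
proof (cases g)
  case (fields a b c d)
  have nz: "of_real c * z + of_real d \<noteq> 0" using mob_denom_nz assms fields by metis
  have "of_real a * of_real d - of_real b * of_real c = (1::complex)"
    using assms(1) unfolding fields by (metis mdet.simps of_real_1 of_real_diff of_real_mult)
  hence "of_real a * (of_real c * z + of_real d) - (of_real a * z + of_real b) * of_real c = (1::complex)"
    by (simp add: algebra_simps)
  thus ?thesis unfolding fields mob.simps[abs_def] using nz
    by (auto intro!: derivative_eq_intros simp: power2_eq_square)
qed

lemma mob_holomorphic: "mdet g = 1 \<Longrightarrow> mob g holomorphic_on H2"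
  using has_field_derivative_mob
  by (meson field_differentiable_at_within field_differentiable_def holomorphic_onI)

text \<open>A fixed point in the upper half plane is a non-real root of \<open>c z\<^sup>2 + (d - a) z - b\<close>, so the
  discriminant \<open>(a + d)\<^sup>2 - 4\<close> is negative and the root is determined.\<close>

lemma mob_fixed_point:
  assumes "mdet g = 1" "z \<in> H2" "mob g z = z" "dmob g z \<noteq> 1"
  shows "\<bar>mtr g\<bar> < 2" and "w \<in> H2 \<Longrightarrow> mob g w = w \<Longrightarrow> w = z"
proof -
  obtain a b c d where g: "g = (a,b,c,d)" by (cases g)
  have det: "a * d - b * c = 1" using assms g by simp
  have root: "c * (Re w ^ 2 - Im w ^ 2) + (d - a) * Re w - b = 0 \<and> 2 * c * Re w + d - a = 0"
    if "w \<in> H2" "mob g w = w" for w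
  proof -
    have nz: "of_real c * w + of_real d \<noteq> 0" using mob_denom_nz assms(1) that g by metis
    have e: "of_real a * w + of_real b = w * (of_real c * w + of_real d)"
      using that(2) nz unfolding g by (simp add: field_simps)
    have "Im w * (2 * c * Re w + d - a) = 0" 
      using arg_cong[OF e, of Im] by (simp add: algebra_simps)
    moreover have "c * (Re w ^ 2 - Im w ^ 2) + (d - a) * Re w - b = 0"
      using arg_cong[OF e, of Re] by (simp add: algebra_simps power2_eq_square)
    ultimately show ?thesis using that(1) by (auto simp: H2_def)
  qed
  have c: "c \<noteq> 0"
  proof
    assume c0: "c = 0"
    with root[OF assms(2,3)] have "d = a" by simp
    with det c0 have "d^2 = 1" by (simp add: power2_eq_square)
    hence "(of_real d :: complex)^2 = 1" by (metis of_real_1 of_real_power)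
    thus False using assms(4) c0 unfolding g by simp
  qed
  have a: "a = 2 * c * Re z + d" using root[OF assms(2,3)] by simp
  have b: "b = c * (Re z ^ 2 - Im z ^ 2) + (d - a) * Re z" using root[OF assms(2,3)] by simp
  have "(a + d)^2 = 4 * (a * d - b * c) - 4 * c^2 * (Im z)^2"
    unfolding b unfolding a by (simp add: algebra_simps power2_eq_square)
  also have "\<dots> < 2^2" using c assms(2) det by (simp add: H2_def)
  finally have "(a + d)^2 < 2^2" .
  hence "\<bar>a + d\<bar>^2 < 2^2" by simp
  thus "\<bar>mtr g\<bar> < 2" unfolding g mtr.simps by (rule power_less_imp_less_base) simp
  assume w: "w \<in> H2" "mob g w = w"
  have re: "Re w = Re z" using root[OF w] root[OF assms(2,3)] c by (auto simp: algebra_simps)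
  have "c * (Im w ^ 2 - Im z ^ 2) = 0" using root[OF w] root[OF assms(2,3)] unfolding re by (simp add: algebra_simps)
  hence "Im w ^ 2 = Im z ^ 2" using c by simp
  hence "Im w = Im z" using w(1) assms(2) by (auto simp: H2_def power2_eq_iff)
  thus "w = z" using re by (simp add: complex_eq_iff)
qed

section \<open>Powers of the two generators\<close>

fun mpow :: "mat2 \<Rightarrow> nat \<Rightarrow> mat2" where
  "mpow g 0 = mone"
| "mpow g (Suc n) = mmul g (mpow g n)"

lemma mpow_add: "mpow g (m + n) = mmul (mpow g m) (mpow g n)"
  by (induction m) (simp_all add: mmul_assoc)

lemma mdet_mpow: "mdet g = 1 \<Longrightarrow> mdet (mpow g n) = 1"
  by (induction n) (simp_all add: mdet_mmul)

lemma Gamma_mpow: "g \<in> Gamma p q \<Longrightarrow> mpow g n \<in> Gamma p q"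
  by (induction n) (simp_all add: Gamma.one Gamma_mmul)

lemma mpow_fixed:
  assumes "mdet g = 1" "z \<in> H2" "mob g z = z"
  shows "mob (mpow g n) z = z" and "dmob (mpow g n) z = dmob g z ^ n"
  by (induction n) (simp_all add: mob_mmul mdet_mpow assms)

text \<open>The entries are Chebyshev polynomials of the second kind at cos t, written with sines;
  the product-to-sum identity is their recurrence. In this form both the period of
  \<open>A0 p\<close> up to sign and the signs of the entries can be read off.\<close>

lemma mpow_A0:
  assumes "p \<ge> 2"
  defines "t \<equiv> pi / real p"
  shows "mpow (A0 p) n = (sin ((real n + 1) * t) / sin t, sin (real n * t) / sin t,
    - sin (real n * t) / sin t, - sin ((real n - 1) * t) / sin t)"
proof -
  have s: "sin t > 0" using assms by (intro sin_gt_zero) (auto simp: field_simps)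
  have 1: "2 * cos t * sin (x * t) = sin ((x + 1) * t) + sin ((x - 1) * t)" for x
    by (simp add: ring_distribs sin_add sin_diff)
  show ?thesis
  proof (induction n)
    case 0 thus ?case using s by simp
  next
    case (Suc n)
    show ?case unfolding mpow.simps Suc using s 1[of "real n"] 1[of "real n + 1"]
      by (simp add: A0_def flip: t_def add: field_simps)
  qed
qed

text \<open>Reflection in the antidiagonal. It reverses products and exchanges \<open>A0 q\<close>
  with \<open>B0 q\<close>, so facts about powers of \<open>A0\<close> carry over to
  \<open>B0\<close>.\<close>

fun mflip :: "mat2 \<Rightarrow> mat2" where "mflip (a,b,c,d) = (d,b,c,a)"

lemma mflip_mmul: "mflip (mmul x y) = mmul (mflip y) (mflip x)"
  by (cases x; cases y) (simp add: algebra_simps)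

lemma mpow_Suc_right: "mpow g (Suc n) = mmul (mpow g n) g"
  using mpow_add[of g n 1] by simp

lemma mflip_mpow: "mflip (mpow g n) = mpow (mflip g) n"
proof (induction n)
  case (Suc n)
  have "mflip (mpow g (Suc n)) = mmul (mflip (mpow g n)) (mflip g)" by (simp add: mflip_mmul)
  thus ?case by (simp add: Suc mpow_Suc_right del: mpow.simps)
qed simp

lemma B0_eq_mflip: "B0 q = mflip (A0 q)"
  by (simp add: A0_def B0_def)

lemma mpow_A0_period: "p \<ge> 2 \<Longrightarrow> mpow (A0 p) p = mneg mone"
proof -
  assume p: "p \<ge> 2"
  have "sin (pi / real p) > 0" using p by (intro sin_gt_zero) (auto simp: field_simps)
  moreover have "real p * (pi / real p) = pi" using p by simp
  moreover have "sin ((real p + 1) * (pi / real p)) = - sin (pi / real p)"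
    "sin ((real p - 1) * (pi / real p)) = sin (pi / real p)"
    using calculation(2) by (simp_all only: distrib_right left_diff_distrib) simp_all
  ultimately show ?thesis by (simp only: mpow_A0[OF p]) simp
qed

lemma mpow_mult_period:
  assumes "mpow g n = mneg mone"
  shows "mpow g (n * k) = mone \<or> mpow g (n * k) = mneg mone"
  by (induction k) (auto simp: mpow_add assms)

section \<open>Words in the generators, up to sign\<close>

text \<open>Equality of classes in PSL2(R).\<close>

definition pmeq :: "mat2 \<Rightarrow> mat2 \<Rightarrow> bool" where
  "pmeq x y \<longleftrightarrow> x = y \<or> x = mneg y"

lemma pmeq_mmul: "pmeq x x' \<Longrightarrow> pmeq y y' \<Longrightarrow> pmeq (mmul x y) (mmul x' y')"
  by (auto simp: pmeq_def mneg_mmul)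

lemma pmeq_refl [simp]: "pmeq x x"
  by (simp add: pmeq_def)

lemma pmeq_trans: "pmeq x y \<Longrightarrow> pmeq y z \<Longrightarrow> pmeq x z"
  by (auto simp: pmeq_def)

lemma pmeq_mpow_mod:
  assumes "mpow g n = mneg mone"
  shows "pmeq (mpow g i) (mpow g (i mod n))"
proof -
  have "mpow g i = mmul (mpow g (n * (i div n))) (mpow g (i mod n))"
    by (simp flip: mpow_add)
  thus ?thesis using mpow_mult_period[OF assms, of "i div n"]
    by (auto simp: pmeq_def mneg_mmul simp del: mneg.simps)
qed

text \<open>A letter is a syllable of the free product of two cyclic groups: the flag selects
  \<open>A0\<close> or \<open>B0\<close>. Natural exponents suffice, since inverses of the
  generators are themselves powers.\<close>

fun letter :: "nat \<Rightarrow> nat \<Rightarrow> bool \<times> nat \<Rightarrow> mat2" where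
  "letter p q (t, i) = mpow (if t then A0 p else B0 q) i"

fun wprod :: "nat \<Rightarrow> nat \<Rightarrow> (bool \<times> nat) list \<Rightarrow> mat2" where
  "wprod p q [] = mone"
| "wprod p q (x # l) = mmul (letter p q x) (wprod p q l)"

fun trivial_letter :: "nat \<Rightarrow> nat \<Rightarrow> bool \<times> nat \<Rightarrow> bool" where
  "trivial_letter p q (t, i) \<longleftrightarrow> (if t then p else q) dvd i"

lemma wprod_append: "wprod p q (l @ l') = mmul (wprod p q l) (wprod p q l')"
  by (induction l) (simp_all add: mmul_assoc)

lemma letter_Gamma: "letter p q x \<in> Gamma p q"
  by (cases x) (simp add: Gamma_mpow Gamma_gen)

lemma letter_merge: "mmul (letter p q (t,i)) (letter p q (t,j)) = letter p q (t,i+j)"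
  by (simp add: mpow_add)

lemma wprod_Gamma: "wprod p q l \<in> Gamma p q"
  by (induction l) (simp_all add: Gamma.one Gamma_mmul letter_Gamma)

lemma letter_period:
  assumes "p \<ge> 2" "q \<ge> 2"
  shows "mpow (if t then A0 p else B0 q) (if t then p else q) = mneg mone"
proof -
  have "mpow (B0 q) q = mflip (mpow (A0 q) q)" by (simp add: B0_eq_mflip mflip_mpow)
  also have "\<dots> = mneg mone" using assms by (simp add: mpow_A0_period)
  finally show ?thesis using assms by (simp add: mpow_A0_period)
qed

lemma letter_trivial:
  assumes "p \<ge> 2" "q \<ge> 2" "trivial_letter p q x"
  shows "pmeq (letter p q x) mone"
proof -
  obtain t i where x: "x = (t,i)" by (cases x)
  show ?thesis using assms(3) pmeq_mpow_mod[OF letter_period[OF assms(1,2), of t], of i]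
    by (cases t) (auto simp: x)
qed

lemma Gamma_wprod:
  assumes "p \<ge> 2" "q \<ge> 2" "g \<in> Gamma p q"
  shows "\<exists>l. g = wprod p q l"
proof -
  \<comment> \<open>The exponent is 2n - 1 rather than n - 1: the n-th power is minus the identity,
    and the equality wanted here is exact, not up to sign.\<close>
  have inv: "minv (if t then A0 p else B0 q) = letter p q (t, 2 * (if t then p else q) - 1)" for t
  proof -
    define n where "n = (if t then p else q)"
    define x where "x = (if t then A0 p else B0 q)"
    have "2 * n = Suc (2 * n - 1)" using assms by (auto simp: n_def)
    hence "mmul x (mpow x (2 * n - 1)) = mpow x (n + n)" by (metis mpow.simps(2) mult_2)
    also have "\<dots> = mone" using letter_period[OF assms(1,2), of t]
      by (simp only: mpow_add flip: n_def x_def) simp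
    finally have "mmul (minv x) (mmul x (mpow x (2 * n - 1))) = minv x" by simp
    moreover have "mdet x = 1" by (simp add: x_def mdet_gen)
    ultimately show ?thesis by (simp add: x_def n_def mmul_minv flip: mmul_assoc)
  qed
  show ?thesis using assms(3)
  proof (induction rule: Gamma.induct)
    case one show ?case by (rule exI[of _ "[]"]) simp
  next
    case (mA g)
    then obtain l where "g = wprod p q l" by blast
    thus ?case by (intro exI[of _ "(True,1) # l"]) simp
  next
    case (mAi g)
    then obtain l where "g = wprod p q l" by blast
    thus ?case using inv[of True] by (intro exI[of _ "(True,2*p-1) # l"]) (simp add: minv_gen)
  next
    case (mB g)
    then obtain l where "g = wprod p q l" by blast
    thus ?case by (intro exI[of _ "(False,1) # l"]) simp
  next
    case (mBi g)
    then obtain l where "g = wprod p q l" by blast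
    thus ?case using inv[of False] by (intro exI[of _ "(False,2*q-1) # l"]) (simp add: minv_gen)
  qed
qed

text \<open>Words range over a countable type. Countability is what later turns a group element
  chosen point by point into a single one.\<close>

lemma countable_Gamma:
  assumes "p \<ge> 2" "q \<ge> 2"
  shows "countable (Gamma p q)"
proof -
  have "Gamma p q \<subseteq> range (wprod p q)" using Gamma_wprod[OF assms] by blast
  thus ?thesis by (rule countable_subset) simp
qed

text \<open>Sign patterns of alternating products, indexed by whether the first and the last letter
  are powers of \<open>A0\<close>. Up to sign they are closed under prepending a letter of the other kind, and
  the two mixed patterns force \<open>\<bar>tr\<bar> \<ge> 2\<close>: the free-product structure is only used in this form.\<close>

fun sign_pattern :: "bool \<Rightarrow> bool \<Rightarrow> mat2 \<Rightarrow> bool" where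
  "sign_pattern True True (a,b,c,d) \<longleftrightarrow> a \<ge> 0 \<and> b > 0 \<and> c < 0 \<and> d \<le> 0"
| "sign_pattern False False (a,b,c,d) \<longleftrightarrow> a \<le> 0 \<and> b > 0 \<and> c < 0 \<and> d \<ge> 0"
| "sign_pattern True False (a,b,c,d) \<longleftrightarrow> a > 0 \<and> b \<le> 0 \<and> c \<le> 0 \<and> d > 0"
| "sign_pattern False True (a,b,c,d) \<longleftrightarrow> a > 0 \<and> b \<ge> 0 \<and> c \<ge> 0 \<and> d > 0"

lemma sign_pattern_prepend:
  assumes "sign_pattern s s x" "sign_pattern (\<not> s) t y"
  shows "\<exists>z. pmeq (mmul x y) z \<and> sign_pattern s t z"
proof -
  obtain a b c d where x: "x = (a,b,c,d)" by (cases x)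
  obtain a' b' c' d' where y: "y = (a',b',c',d')" by (cases y)
  consider "s" "t" | "s" "\<not> t" | "\<not> s" "t" | "\<not> s" "\<not> t" by blast
  thus ?thesis
  proof cases
    case 1
    have "a*a' \<ge> 0" "b*c' \<ge> 0" "a*b' \<ge> 0" "b*d' > 0" "c*a' < 0" "d*c' \<le> 0" "c*b' \<le> 0" "d*d' \<le> 0"
      using assms 1 by (auto simp: x y mult_nonneg_nonneg mult_pos_pos mult_neg_pos mult_nonpos_nonneg)
    hence "sign_pattern s t (mmul x y)" using 1 by (simp add: x y)
    thus ?thesis by (intro exI[of _ "mmul x y"]) simp
  next
    case 2
    have "a*a' \<le> 0" "b*c' < 0" "a*b' \<ge> 0" "b*d' \<ge> 0" "c*a' \<ge> 0" "d*c' \<ge> 0" "c*b' < 0" "d*d' \<le> 0"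
      using assms 2 by (auto simp: x y mult_nonneg_nonneg mult_pos_neg mult_neg_pos mult_nonneg_nonpos
        mult_nonpos_nonneg mult_nonpos_nonpos)
    \<comment> \<open>Every entry of the product has the sign opposite to the pattern, so the other
      representative of the class is taken.\<close>
    hence "sign_pattern s t (mneg (mmul x y))" using 2 by (simp add: x y)
    thus ?thesis by (intro exI[of _ "mneg (mmul x y)"]) (simp add: pmeq_def)
  next
    case 3
    have "a*a' \<le> 0" "b*c' < 0" "a*b' \<le> 0" "b*d' \<le> 0" "c*a' \<le> 0" "d*c' \<le> 0" "c*b' < 0" "d*d' \<le> 0"
      using assms 3 by (auto simp: x y mult_nonneg_nonneg mult_pos_neg mult_neg_pos mult_nonneg_nonpos
        mult_nonpos_nonneg mult_nonpos_nonpos)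
    hence "sign_pattern s t (mneg (mmul x y))" using 3 by (simp add: x y)
    thus ?thesis by (intro exI[of _ "mneg (mmul x y)"]) (simp add: pmeq_def)
  next
    case 4
    have "a*a' \<le> 0" "b*c' \<le> 0" "a*b' \<ge> 0" "b*d' > 0" "c*a' < 0" "d*c' \<le> 0" "c*b' \<ge> 0" "d*d' \<ge> 0"
      using assms 4 by (auto simp: x y mult_nonneg_nonneg mult_pos_neg mult_neg_pos mult_nonneg_nonpos
        mult_nonpos_nonneg mult_nonpos_nonpos)
    hence "sign_pattern s t (mmul x y)" using 4 by (simp add: x y)
    thus ?thesis by (intro exI[of _ "mmul x y"]) simp
  qed
qed

text \<open>Reducing the exponent modulo the period leaves 0 < k < n. There the sine at k pi/n is
  positive and those at (k - 1) pi/n and (k + 1) pi/n are nonnegative, which are the signs required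
  of a power of \<open>A0\<close>; \<open>mflip\<close> handles \<open>B0\<close>.\<close>

lemma sign_pattern_letter:
  assumes "p \<ge> 2" "q \<ge> 2" "\<not> trivial_letter p q x"
  shows "\<exists>z. pmeq (letter p q x) z \<and> sign_pattern (fst x) (fst x) z"
proof -
  obtain t i where x: "x = (t,i)" by (cases x)
  define n where "n = (if t then p else q)"
  define k where "k = i mod n"
  have n: "n \<ge> 2" using assms by (simp add: n_def)
  have k: "0 < k" "k < n" using assms(3) n unfolding k_def
    by (auto simp: x n_def mod_greater_zero_iff_not_dvd)
  have s: "sin (pi / real n) > 0" using n by (intro sin_gt_zero) (auto simp: field_simps)
  have 1: "sin (real k * (pi / real n)) > 0"
    using k by (intro sin_gt_zero) (auto simp: field_simps)
  have "(real k + 1) * (pi / real n) \<le> real n * (pi / real n)"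
    using k by (intro mult_right_mono) auto
  hence 2: "sin ((real k + 1) * (pi / real n)) \<ge> 0"
    using k by (intro sin_ge_zero) auto
  have "(real k - 1) * (pi / real n) \<le> real n * (pi / real n)"
    using k by (intro mult_right_mono) auto
  hence 3: "sin ((real k - 1) * (pi / real n)) \<ge> 0"
    using k by (intro sin_ge_zero) auto
  have sp: "sign_pattern True True (mpow (A0 n) k)"
    using s 1 2 3 by (simp add: mpow_A0[OF n])
  have fl: "sign_pattern False False (mflip z)" if "sign_pattern True True z" for z
    using that by (cases z) simp
  have "sign_pattern t t (mpow (if t then A0 p else B0 q) k)"
    using sp fl[OF sp] by (auto simp: n_def mflip_mpow B0_eq_mflip split: if_splits)
  moreover have "pmeq (letter p q x) (mpow (if t then A0 p else B0 q) k)"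
    using pmeq_mpow_mod[OF letter_period[OF assms(1,2), of t], of i] by (simp add: x n_def k_def)
  ultimately show ?thesis unfolding x fst_conv by blast
qed

text \<open>Prepending one letter at a time: in an alternating word of nontrivial letters only the
  kinds of the two end letters influence the pattern.\<close>

lemma sign_pattern_wprod:
  assumes "p \<ge> 2" "q \<ge> 2" "l \<noteq> []" "\<forall>x\<in>set l. \<not> trivial_letter p q x"
    and "successively (\<lambda>x y. fst x \<noteq> fst y) l"
  shows "\<exists>z. pmeq (wprod p q l) z \<and> sign_pattern (fst (hd l)) (fst (last l)) z"
  using assms(3-)
proof (induction l)
  case (Cons x l)
  obtain z where z: "pmeq (letter p q x) z" "sign_pattern (fst x) (fst x) z"
    using sign_pattern_letter[OF assms(1,2)] Cons.prems by (meson list.set_intros(1))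
  show ?case
  proof (cases "l = []")
    case True
    thus ?thesis using z by (intro exI[of _ z]) simp
  next
    case False
    obtain z' where z': "pmeq (wprod p q l) z'" "sign_pattern (fst (hd l)) (fst (last l)) z'"
      using Cons False by (auto simp: successively_Cons)
    have "fst (hd l) = (\<not> fst x)" using Cons.prems False by (auto simp: successively_Cons)
    then obtain y where "pmeq (mmul z z') y" "sign_pattern (fst x) (fst (last l)) y"
      using sign_pattern_prepend[OF z(2), of "fst (last l)" z'] z'(2) by auto
    thus ?thesis using False pmeq_trans[OF pmeq_mmul[OF z(1) z'(1)]]
      by (intro exI[of _ y]) simp
  qed
qed simp

section \<open>Traces of words and elliptic elements\<close>

text \<open>In a mixed pattern a and d are positive and bc is nonnegative, so ad = 1 + bc is at
  least 1 and the arithmetic-geometric mean inequality bounds a + d.\<close>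

lemma mtr_mixed_pattern:
  assumes "pmeq g z" "sign_pattern s t z" "s \<noteq> t" "mdet g = 1"
  shows "\<bar>mtr g\<bar> \<ge> 2"
proof -
  obtain a b c d where z: "z = (a,b,c,d)" by (cases z)
  have det: "a * d - b * c = 1" using assms by (cases g) (auto simp: pmeq_def z)
  have pos: "a > 0" "d > 0" "b * c \<ge> 0"
    using assms(2,3) by (cases s; cases t; auto simp: z mult_nonneg_nonneg mult_nonpos_nonpos)+
  have "(a + d)^2 = (a - d)^2 + 4 * (a * d)" by (simp add: power2_eq_square algebra_simps)
  moreover have "a * d \<ge> 1" using det pos by simp
  moreover have "(a - d)^2 \<ge> 0" by simp
  ultimately have "(a + d)^2 \<ge> 2^2" unfolding power2_eq_square[of 2] by linarith
  hence "a + d \<ge> 2" using pos by (meson add_nonneg_nonneg less_imp_le power2_le_imp_le)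
  thus ?thesis using assms(1) by (auto simp: pmeq_def z)
qed

lemma not_successively:
  assumes "\<not> successively (\<lambda>x y. P x y) l"
  shows "\<exists>l1 x y l2. l = l1 @ x # y # l2 \<and> \<not> P x y"
  using assms
proof (induction l rule: induct_list012)
  case (3 x y l)
  show ?case
  proof (cases "P x y")
    case True
    then obtain l1 x' y' l2 where "y # l = l1 @ x' # y' # l2" "\<not> P x' y'" using 3 by auto
    thus ?thesis by (metis append_Cons)
  next
    case False
    thus ?thesis by (metis append_Nil)
  qed
qed simp_all

text \<open>Cyclic reduction, by induction on the length. Trivial letters are dropped, neighbours of
  the same kind are merged, and equal kinds at the two ends are merged after a conjugation. A
  nonempty word that admits none of these moves is a single letter or has a mixed pattern, and the
  latter contradicts the trace bound.\<close>

lemma elliptic_wprod_conj_letter: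
  assumes "p \<ge> 2" "q \<ge> 2" "\<bar>mtr (wprod p q l)\<bar> < 2"
  shows "\<exists>h\<in>Gamma p q. \<exists>x. pmeq (wprod p q l) (mmul h (mmul (letter p q x) (minv h)))"
  using assms(3)
proof (induction "length l" arbitrary: l rule: less_induct)
  case less
  have det: "mdet (wprod p q l) = 1" for l using mdet_Gamma wprod_Gamma by blast
  have pmtr: "\<bar>mtr x\<bar> = \<bar>mtr y\<bar>" if "pmeq x y" for x y
    using that by (cases x; cases y) (auto simp: pmeq_def)
  have pm: ?case if len: "length l' < length l" and eq: "pmeq (wprod p q l) (wprod p q l')" for l'
  proof -
    obtain h x where "h \<in> Gamma p q" "pmeq (wprod p q l') (mmul h (mmul (letter p q x) (minv h)))"
      using less.hyps[OF len] less.prems pmtr[OF eq] by auto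
    thus ?thesis using eq pmeq_trans by blast
  qed
  consider "\<exists>x\<in>set l. trivial_letter p q x"
    | "\<not> successively (\<lambda>x y. fst x \<noteq> fst y) l"
    | "l = []" | x where "l = [x]"
    | "length l \<ge> 2" "fst (hd l) = fst (last l)"
    | "l \<noteq> []" "fst (hd l) \<noteq> fst (last l)" "\<forall>x\<in>set l. \<not> trivial_letter p q x"
      "successively (\<lambda>x y. fst x \<noteq> fst y) l"
    by (cases l rule: remdups_adj.cases) (auto simp: numeral_2_eq_2)
  thus ?case
  proof cases
    case 1
    then obtain l1 x l2 where l: "l = l1 @ x # l2" "trivial_letter p q x"
      by (meson split_list)
    have "pmeq (wprod p q l) (mmul (wprod p q l1) (mmul mone (wprod p q l2)))"
      unfolding l(1) wprod_append wprod.simps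
      by (intro pmeq_mmul letter_trivial assms l) simp_all
    thus ?thesis by (intro pm[of "l1 @ l2"]) (simp_all add: l wprod_append)
  next
    case 2
    then obtain l1 x y l2 where l: "l = l1 @ x # y # l2" "fst x = fst y"
      using not_successively by blast
    obtain t i j where xy: "x = (t,i)" "y = (t,j)" using l(2) by (cases x; cases y) auto
    have "wprod p q l = wprod p q (l1 @ (t,i+j) # l2)"
      unfolding l xy wprod_append wprod.simps letter_merge[symmetric] by (simp add: mmul_assoc)
    thus ?thesis by (intro pm[of "l1 @ (t,i+j) # l2"]) (simp_all add: l)
  next
    case 3
    show ?thesis by (intro bexI[of _ mone] exI[of _ "(True,0)"]) (simp_all add: 3 Gamma.one)
  next
    case (4 x)
    show ?thesis by (intro bexI[of _ mone] exI[of _ x]) (simp_all add: 4 Gamma.one)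
  next
    case 5
    obtain x l0 where l0: "l = x # l0" "l0 \<noteq> []" using 5(1) by (cases l) fastforce+
    then obtain l1 y where l: "l = x # l1 @ [y]" by (metis append_butlast_last_id)
    obtain t i j where xy: "x = (t,i)" "y = (t,j)" using l 5(2) by (cases x; cases y) auto
    \<comment> \<open>Conjugating by the first letter carries it to the far end, where it merges
      with the last one. The word \<open>l'\<close> is shorter and has the same trace.\<close>
    define X where "X = letter p q x"
    define l' where "l' = l1 @ [(t,j+i)]"
    have X: "X \<in> Gamma p q" "mdet X = 1" using letter_Gamma mdet_Gamma X_def by blast+
    have l'e: "wprod p q l' = mmul (wprod p q l1) (mmul (letter p q y) X)"
      unfolding l'_def wprod_append xy X_def letter_merge by simp
    have le: "wprod p q l = mmul X (mmul (wprod p q l1) (letter p q y))"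
      unfolding l wprod_append wprod.simps X_def by simp
    have "mtr (wprod p q l') = mtr (wprod p q l)"
      unfolding le l'e by (metis mmul_assoc mtr_commute)
    then obtain h z where h: "h \<in> Gamma p q" "pmeq (wprod p q l') (mmul h (mmul (letter p q z) (minv h)))"
      using less.hyps[of l'] less.prems by (auto simp: l l'_def)
    have "wprod p q l = mmul X (mmul (wprod p q l') (minv X))"
      unfolding le l'e by (simp add: mmul_assoc mmul_minv X)
    moreover have "pmeq \<dots> (mmul X (mmul (mmul h (mmul (letter p q z) (minv h))) (minv X)))"
      by (intro pmeq_mmul h) simp_all
    moreover have "mmul X (mmul (mmul h (mmul (letter p q z) (minv h))) (minv X))
      = mmul (mmul X h) (mmul (letter p q z) (minv (mmul X h)))"
      by (simp add: mmul_assoc minv_mmul)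
    ultimately show ?thesis using Gamma_mmul[OF X(1) h(1)]
      by (intro bexI[of _ "mmul X h"] exI[of _ z]) auto
  next
    case 6
    obtain z where "pmeq (wprod p q l) z" "sign_pattern (fst (hd l)) (fst (last l)) z"
      using sign_pattern_wprod[OF assms(1,2) 6(1,3,4)] by blast
    from mtr_mixed_pattern[OF this 6(2) det] less.prems show ?thesis by simp
  qed
qed

section \<open>Fixed points of the generators and stabilizers\<close>

definition apt :: "nat \<Rightarrow> complex" where
  "apt p = Complex (- cos (pi / real p)) (sin (pi / real p))"

definition bpt :: "nat \<Rightarrow> complex" where
  "bpt q = Complex (cos (pi / real q)) (sin (pi / real q))"

lemma apt_bpt_in_H2: "n \<ge> 2 \<Longrightarrow> apt n \<in> H2" "n \<ge> 2 \<Longrightarrow> bpt n \<in> H2"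
  by (auto simp: apt_def bpt_def H2_def field_simps intro!: sin_gt_zero)

lemma apt_eq: "apt p = - cis (- (pi / real p))"
  and bpt_eq: "bpt q = cis (pi / real q)"
  by (simp_all add: apt_def bpt_def complex_eq_iff)

lemma cis_plus_cis_minus: "complex_of_real (2 * cos x) = cis x + cis (- x)"
  by (simp add: complex_eq_iff)

text \<open>With the fixed point written as -cis(-t), the sum 2 cos t = cis t + cis(-t) cancels
  against it. The derivative is a primitive p-th root of unity, so the powers of \<open>A0 p\<close>
  realize all p-th roots of unity as rotations.\<close>

lemma A0_apt: "mob (A0 p) (apt p) = apt p" "dmob (A0 p) (apt p) = cis (2 * pi / real p)"
proof -
  define t where "t = pi / real p"
  have "(of_real (2 * cos t) * (- cis (- t)) + 1) / cis (- t) = - cis (- t)"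
    by (simp only: cis_plus_cis_minus) (simp add: field_simps cis_mult)
  thus "mob (A0 p) (apt p) = apt p"
    by (simp add: A0_def apt_eq flip: t_def)
  have "1 / cis (- t) ^ 2 = cis (2 * t)"
    by (simp add: field_simps power2_eq_square cis_mult)
  thus "dmob (A0 p) (apt p) = cis (2 * pi / real p)"
    by (simp add: A0_def apt_eq t_def)
qed

lemma B0_bpt: "mob (B0 q) (bpt q) = bpt q" "dmob (B0 q) (bpt q) = cis (2 * pi / real q)"
proof -
  define t where "t = pi / real q"
  have e: "- cis t + complex_of_real (2 * cos t) = cis (- t)"
    by (simp only: cis_plus_cis_minus) simp
  have "1 / (- cis t + of_real (2 * cos t)) = cis t"
    unfolding e by (simp add: field_simps cis_mult)
  thus "mob (B0 q) (bpt q) = bpt q"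
    by (simp add: B0_def bpt_eq flip: t_def)
  have "1 / (- cis t + of_real (2 * cos t)) ^ 2 = cis (2 * t)"
    unfolding e by (simp add: field_simps power2_eq_square cis_mult)
  thus "dmob (B0 q) (bpt q) = cis (2 * pi / real q)"
    by (simp add: B0_def bpt_eq t_def)
qed

lemma mob_pmeq: "pmeq x y \<Longrightarrow> mob x z = mob y z" "pmeq x y \<Longrightarrow> dmob x z = dmob y z"
proof -
  obtain a b c d where y: "y = (a,b,c,d)" by (cases y)
  have e: "- (of_real c * z) - of_real d = - (of_real c * z + of_real d)"
    "- (of_real a * z) - of_real b = - (of_real a * z + of_real b)" by simp_all
  show "pmeq x y \<Longrightarrow> mob x z = mob y z"
    unfolding pmeq_def y by (auto simp: e simp del: minus_add_distrib minus_add)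
  show "pmeq x y \<Longrightarrow> dmob x z = dmob y z"
    unfolding pmeq_def y by (auto simp: e power2_minus simp del: minus_add_distrib minus_add)
qed

lemma mob_minv:
  assumes "mdet h = 1" "z \<in> H2"
  shows "mob h (mob (minv h) z) = z" "mob (minv h) (mob h z) = z"
    and "dmob h (mob (minv h) z) * dmob (minv h) z = 1"
proof -
  have "mdet (minv h) = 1" using assms by (cases h) (simp add: mult.commute)
  thus "mob h (mob (minv h) z) = z" "mob (minv h) (mob h z) = z"
    "dmob h (mob (minv h) z) * dmob (minv h) z = 1"
    using mob_mmul[of h "minv h" z] mob_mmul[of "minv h" h z] assms
    by (simp_all add: mmul_minv)
qed

text \<open>A nontrivial derivative at a fixed point forces a trace of modulus below 2, so g is up
  to sign a conjugate of a letter. By the chain rule the derivative at the fixed point is invariant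
  under the conjugation, which reduces the claim to powers of a generator.\<close>

lemma Gamma_fixed_point:
  assumes pq: "p \<ge> 2" "q \<ge> 2" and g: "g \<in> Gamma p q" and z: "z \<in> H2" "mob g z = z" "dmob g z \<noteq> 1"
  shows "(\<exists>h\<in>Gamma p q. z = mob h (apt p) \<and> dmob g z ^ p = 1)
       \<or> (\<exists>h\<in>Gamma p q. z = mob h (bpt q) \<and> dmob g z ^ q = 1)"
proof -
  obtain l where l: "g = wprod p q l" using Gamma_wprod[OF pq g] by blast
  have "\<bar>mtr g\<bar> < 2" using mob_fixed_point(1) mdet_Gamma g z by blast
  then obtain h x where h: "h \<in> Gamma p q" and pm: "pmeq g (mmul h (mmul (letter p q x) (minv h)))"
    using elliptic_wprod_conj_letter[OF pq] unfolding l by blast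
  define X where "X = letter p q x"
  define w where "w = mob (minv h) z"
  have hi: "minv h \<in> Gamma p q" using h by (rule Gamma_minv)
  have det: "mdet h = 1" "mdet (minv h) = 1" "mdet X = 1"
    using h hi letter_Gamma mdet_Gamma X_def by blast+
  have w: "w \<in> H2" unfolding w_def using mob_in_H2 det z by blast
  have Xw: "mob X w \<in> H2" using w det mob_in_H2 by blast
  have z_eq: "z = mob h w" unfolding w_def using mob_minv det z by simp
  have "mob h (mob X w) = z"
    using z(2) mob_pmeq(1)[OF pm, of z] det z(1) w unfolding X_def[symmetric]
    by (simp add: mob_mmul mdet_mmul flip: w_def)
  hence fixX: "mob X w = w" using mob_minv(2)[OF det(1) Xw] by (simp add: w_def)
  have "dmob g z = dmob h (mob X w) * (dmob X w * dmob (minv h) z)"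
    using mob_pmeq(2)[OF pm, of z] det z(1) w unfolding X_def[symmetric]
    by (simp add: mob_mmul mdet_mmul flip: w_def)
  also have "\<dots> = dmob X w" unfolding fixX using mob_minv(3)[OF det(1) z(1)]
    by (simp add: w_def ac_simps)
  finally have d: "dmob g z = dmob X w" .
  hence nt: "dmob X w \<noteq> 1" using z by simp
  obtain t i where x: "x = (t,i)" by (cases x)
  \<comment> \<open>\<open>X\<close> is a power of a generator, hence fixes that generator's fixed
    point \<open>c\<close>. Its derivative at \<open>w\<close> is not 1, so \<open>w\<close> is its
    only fixed point in the half plane.\<close>
  have key: "w = c \<and> dmob X w ^ n = 1" if "X = mpow y i" "mdet y = 1" "c \<in> H2" "mob y c = c"
    "dmob y c = cis (2 * pi / real n)" "n \<ge> 2" for y c n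
  proof -
    have "mob X c = c" using mpow_fixed(1) that by simp
    hence wc: "w = c" using mob_fixed_point(2)[OF det(3) w fixX nt that(3)] by simp
    have "cis (2 * pi / real n) ^ n = 1" using that(6) by (simp only: Complex.DeMoivre) simp
    hence "dmob X w ^ n = 1" unfolding wc using mpow_fixed(2)[OF that(2-4), of i] that(1,5)
      by (simp add: power_mult[symmetric] mult.commute[of i]) (simp add: power_mult)
    with wc show ?thesis by simp
  qed
  show ?thesis
  proof (cases t)
    case True
    have "w = apt p \<and> dmob X w ^ p = 1"
      by (rule key[of "A0 p"]) (use True in \<open>auto simp: X_def x mdet_gen apt_bpt_in_H2 A0_apt pq\<close>)
    thus ?thesis using h z_eq d by auto
  next
    case False
    have "w = bpt q \<and> dmob X w ^ q = 1"
      by (rule key[of "B0 q"]) (use False in \<open>auto simp: X_def x mdet_gen apt_bpt_in_H2 B0_bpt pq\<close>)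
    thus ?thesis using h z_eq d by auto
  qed
qed

section \<open>Holomorphic functions and roots of unity\<close>

lemma H2_open: "open H2" and H2_connected: "connected H2"
  unfolding H2_def by (simp_all add: open_halfspace_Im_gt convex_halfspace_Im_gt convex_connected)

text \<open>If no index worked, each function would agree with f at only finitely many points of a
  closed disc, and the disc would be a countable union of finite sets.\<close>

lemma holomorphic_eq_one_of_countably_many:
  assumes S: "open S" "connected S" "S \<noteq> {}" and f: "f holomorphic_on S"
    and I: "countable I" and G: "\<And>i. i \<in> I \<Longrightarrow> G i holomorphic_on S"
    and ex: "\<And>z. z \<in> S \<Longrightarrow> \<exists>i\<in>I. f z = G i z"
  shows "\<exists>i\<in>I. \<forall>z\<in>S. f z = G i z"
proof (rule ccontr)
  assume neg: "\<not> ?thesis"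
  obtain x e where x: "x \<in> S" "e > 0" "cball x e \<subseteq> S"
    using S by (meson ex_in_conv open_contains_cball)
  have fin: "finite {z \<in> cball x e. f z - G i z = 0}" if "i \<in> I" for i
  proof (cases "(\<lambda>z. f z - G i z) constant_on S")
    case False
    thus ?thesis using that f G S x
      by (intro holomorphic_compact_finite_zeros[of _ S] holomorphic_intros) auto
  next
    case True
    then obtain c where c: "\<And>z. z \<in> S \<Longrightarrow> f z - G i z = c" unfolding constant_on_def by blast
    have "c \<noteq> 0" using neg that c by force
    hence "{z \<in> cball x e. f z - G i z = 0} = {}" using c x by blast
    thus ?thesis by (metis finite.emptyI)
  qed
  have "cball x e \<subseteq> (\<Union>i\<in>I. {z \<in> cball x e. f z - G i z = 0})"
    using ex x by force
  moreover have "countable (\<Union>i\<in>I. {z \<in> cball x e. f z - G i z = 0})"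
    using I fin by (intro countable_UN) (auto intro: countable_finite)
  ultimately have "countable (cball x e)" by (rule countable_subset)
  thus False using x by (simp add: uncountable_cball)
qed

text \<open>Here n is the multiplicity with which f takes its value at z. The nonvanishing cofactor
  has an n-th root near z, and absorbing it into w - z gives a local coordinate \<phi>.\<close>

lemma holomorphic_local_power:
  assumes f: "f holomorphic_on S" "open S" "connected S" "\<not> f constant_on S" and z: "z \<in> S"
  obtains n \<phi> \<rho> where "n > 0" "\<rho> > 0" "ball z \<rho> \<subseteq> S" "\<phi> holomorphic_on ball z \<rho>"
    "\<phi> z = 0" "deriv \<phi> z \<noteq> 0" "inj_on \<phi> (ball z \<rho>)"
    "\<And>w. w \<in> ball z \<rho> \<Longrightarrow> f w - f z = \<phi> w ^ n"
proof -
  have "\<exists>n>0. (deriv ^^ n) f z \<noteq> 0"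
  proof (rule ccontr)
    assume "\<not> ?thesis"
    hence "f w = f z" if "w \<in> S" for w
      using holomorphic_fun_eq_const_on_connected[OF f(1-3) _ z that] by blast
    thus False using f(4) unfolding constant_on_def by blast
  qed
  then obtain n where n: "n > 0 \<and> (deriv ^^ n) f z \<noteq> 0"
    and least: "\<And>k. k < n \<Longrightarrow> \<not> (k > 0 \<and> (deriv ^^ k) f z \<noteq> 0)"
    using exists_least_iff[of "\<lambda>n. n > 0 \<and> (deriv ^^ n) f z \<noteq> 0"] by blast
  obtain g r where g: "r > 0" "g holomorphic_on ball z r"
      "\<And>w. w \<in> ball z r \<Longrightarrow> f w - f z = ((w - z) * g w) ^ n"
      "\<And>w. w \<in> ball z r \<Longrightarrow> g w \<noteq> 0"
    by (rule holomorphic_factor_order_of_zero_strong[OF f(1,2) z, of n]) (use n least in blast)+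
  define \<phi> where "\<phi> = (\<lambda>w. (w - z) * g w)"
  have hol: "\<phi> holomorphic_on ball z r" unfolding \<phi>_def by (intro holomorphic_intros g)
  have gd: "(g has_field_derivative deriv g z) (at z)"
    using g by (intro holomorphic_derivI[of _ "ball z r"]) auto
  have "(\<phi> has_field_derivative g z) (at z)"
    unfolding \<phi>_def by (auto intro!: derivative_eq_intros gd)
  hence d: "deriv \<phi> z \<noteq> 0" using g by (simp add: DERIV_imp_deriv)
  have "z \<in> ball z r \<inter> S" "open (ball z r \<inter> S)" using g z f by auto
  moreover have "\<phi> holomorphic_on ball z r \<inter> S" using hol holomorphic_on_subset by blast
  ultimately obtain \<rho> where \<rho>: "\<rho> > 0" "ball z \<rho> \<subseteq> ball z r \<inter> S" "inj_on \<phi> (ball z \<rho>)"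
    using has_complex_derivative_locally_invertible[of \<phi> "ball z r \<inter> S" z] d by blast
  show ?thesis
  proof (rule that[of n \<rho> \<phi>])
    show "\<phi> holomorphic_on ball z \<rho>" using hol \<rho> holomorphic_on_subset by blast
    show "f w - f z = \<phi> w ^ n" if "w \<in> ball z \<rho>" for w
      using g(3) that \<rho>(2) unfolding \<phi>_def by blast
  qed (use n \<rho> d in \<open>auto simp: \<phi>_def\<close>)
qed

text \<open>At each point the ratio of f to g is an n-th root of unity (1 will do where both
  vanish). There are finitely many of these, so one of them serves on all of S.\<close>

lemma holomorphic_power_eq:
  assumes S: "open S" "connected S" "S \<noteq> {}"
    and hol: "f holomorphic_on S" "g holomorphic_on S"
    and eq: "\<And>z. z \<in> S \<Longrightarrow> f z ^ n = g z ^ n" and n: "n > 0"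
  shows "\<exists>c. \<forall>z\<in>S. f z = c * g z"
proof -
  have "\<exists>c\<in>{c. c ^ n = 1}. f z = c * g z" if "z \<in> S" for z
  proof (cases "g z = 0")
    case True
    thus ?thesis using eq[OF that] n by (intro bexI[of _ 1]) (auto simp: zero_power)
  next
    case False
    thus ?thesis using eq[OF that] by (intro bexI[of _ "f z / g z"]) (auto simp: power_divide)
  qed
  moreover have "countable {c :: complex. c ^ n = 1}"
    using n by (intro countable_finite finite_roots_unity) auto
  moreover have "(\<lambda>z. c * g z) holomorphic_on S" for c by (intro holomorphic_intros hol)
  ultimately have "\<exists>c\<in>{c. c ^ n = 1}. \<forall>z\<in>S. f z = c * g z"
    by (intro holomorphic_eq_one_of_countably_many[OF S hol(1)])
  thus ?thesis by blast
qed

section \<open>Roots of unity and coprime exponents\<close>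

text \<open>By Bezout, raising to the power a is invertible on b-th roots of unity, with an inverse
  power s that does not depend on x.\<close>

lemma coprime_power_inverse:
  assumes "coprime a b" "a > 0"
  shows "\<exists>s. \<forall>x::complex. x ^ b = 1 \<longrightarrow> (x ^ s) ^ a = x"
proof -
  obtain s t where "a * s = b * t + 1" using bezout_nat[of a b] assms by auto
  hence "(x ^ s) ^ a = (x ^ b) ^ t * x" for x :: complex
    by (metis mult.commute power_add power_mult power_one_right)
  thus ?thesis by (intro exI[of _ s]) simp
qed

lemma coprime_roots_unity:
  assumes "coprime a b" "a > 0" "x ^ a = 1" "x ^ b = 1"
  shows "x = (1::complex)"
proof -
  obtain s t where "a * s = b * t + 1" using bezout_nat[of a b] assms by auto
  hence "(x ^ a) ^ s = (x ^ b) ^ t * x"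
    by (metis power_add power_mult power_one_right)
  thus ?thesis using assms by simp
qed

text \<open>The powers of exp(2 pi i / r) are all the r-th roots of unity, so the orbit relation can
  be handled with an arbitrary root \<eta>.\<close>

lemma h_equiv_iff:
  assumes r: "r = p * q - p - q" "r > 0"
  shows "h_equiv p q w w' \<longleftrightarrow> (\<exists>\<eta>. \<eta> ^ r = 1 \<and> fst w' = \<eta> ^ p * fst w \<and> snd w' = \<eta> ^ q * snd w)"
proof -
  have pow: "exp (2 * pi * \<i> * of_nat (n * k) / of_nat r) = exp (2 * pi * \<i> * of_nat k / of_nat r) ^ n"
    for n k by (simp flip: exp_of_nat_mult add: mult_ac)
  have one: "exp (2 * pi * \<i> * of_nat k / of_nat r) ^ r = 1" for k
    using complex_root_unity[of r k] r by simp
  have "\<exists>k. \<eta> = exp (2 * pi * \<i> * of_nat k / of_nat r)" if "\<eta> ^ r = 1" for \<eta> :: complex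
    using complex_roots_unity[of r] r that by fastforce
  thus ?thesis unfolding h_equiv_def Let_def pow r(1)[symmetric] using one by blast
qed

text \<open>The r-th powers of the coordinates together with the ratio of X^q to Y^p pin down a
  point modulo the cyclic group. Coprimality extracts \<eta> from one nonzero coordinate; the
  remaining error in the other is both an r-th and a p-th root of unity, hence 1.\<close>

lemma common_root_of_unity:
  fixes X Y X' Y' :: complex
  assumes cop: "coprime p r" "coprime q r" "p > 0" "q > 0" "r > 0"
    and eq: "X' ^ r = X ^ r" "Y' ^ r = Y ^ r" "X' ^ q * Y ^ p = X ^ q * Y' ^ p"
  shows "\<exists>\<eta>. \<eta> ^ r = 1 \<and> X' = \<eta> ^ p * X \<and> Y' = \<eta> ^ q * Y"
proof -
  have root: "\<exists>\<eta>::complex. \<eta> ^ r = 1 \<and> x' = \<eta> ^ n * x"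
    if n: "coprime n r" "n > 0" and x: "x' ^ r = x ^ r" "x \<noteq> 0" for n and x x' :: complex
  proof -
    have 1: "(x' / x) ^ r = 1" using x by (simp add: power_divide)
    then obtain s where s: "((x' / x) ^ s) ^ n = x' / x" using coprime_power_inverse n by blast
    have "((x' / x) ^ s) ^ r = ((x' / x) ^ r) ^ s" by (simp flip: power_mult add: mult.commute)
    thus ?thesis using s 1 x(2) by (intro exI[of _ "(x' / x) ^ s"]) simp
  qed
  show ?thesis
  proof (cases "X = 0")
    case True
    hence X': "X' = 0" using eq cop by (simp add: zero_power)
    show ?thesis
    proof (cases "Y = 0")
      case True
      hence "Y' = 0" using eq cop by (simp add: zero_power)
      thus ?thesis using True \<open>X = 0\<close> X' by (intro exI[of _ 1]) simp
    next
      case False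
      thus ?thesis using root[of q Y' Y] cop eq X' \<open>X = 0\<close> by auto
    qed
  next
    case False
    then obtain \<eta> where \<eta>: "\<eta> ^ r = 1" "X' = \<eta> ^ p * X" using root[of p X' X] cop eq by auto
    have "\<eta> \<noteq> 0" using \<eta> cop by (auto simp: zero_power)
    have "Y' = \<eta> ^ q * Y"
    proof (cases "Y = 0")
      case True
      thus ?thesis using eq cop by (simp add: zero_power)
    next
      case Y: False
      define x where "x = Y' / (\<eta> ^ q * Y)"
      have "(\<eta> ^ q) ^ r = 1" using \<eta>(1) by (metis power_commutes power_mult mult.commute power_one)
      hence "x ^ r = 1" using eq(2) Y by (simp add: x_def power_divide power_mult_distrib)
      moreover have "x ^ p = 1"
      proof -
        have "(\<eta> ^ p) ^ q * Y ^ p = Y' ^ p"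
          using eq(3) False unfolding \<eta>(2) by (simp add: power_mult_distrib)
        moreover have "(\<eta> ^ p) ^ q = (\<eta> ^ q) ^ p" by (simp only: power_mult[symmetric] mult.commute)
        ultimately have "Y' ^ p = (\<eta> ^ q * Y) ^ p" by (simp add: power_mult_distrib)
        thus ?thesis using Y \<open>\<eta> \<noteq> 0\<close> by (simp add: x_def power_divide)
      qed
      ultimately have "x = 1" using coprime_roots_unity cop by blast
      thus ?thesis using Y \<open>\<eta> \<noteq> 0\<close> by (simp add: x_def)
    qed
    thus ?thesis using \<eta> by blast
  qed
qed

lemma bij_complex_linear2:
  fixes a b c d :: complex
  assumes "a * d - b * c \<noteq> 0"
  shows "bij (\<lambda>y. (a * fst y + b * snd y, c * fst y + d * snd y))"
proof (rule o_bij)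
  let ?D = "a * d - b * c"
  let ?g = "\<lambda>y. ((d * fst y - b * snd y) / ?D, (a * snd y - c * fst y) / ?D)"
  have 1: "d * (a * x + b * y) - b * (c * x + d * y) = ?D * x"
    "a * (c * x + d * y) - c * (a * x + b * y) = ?D * y" for x y
    by (simp_all add: algebra_simps)
  have 2: "a * ((d * x - b * y) / ?D) + b * ((a * y - c * x) / ?D) = x"
    "c * ((d * x - b * y) / ?D) + d * ((a * y - c * x) / ?D) = y" for x y
  proof -
    have "a * (d * x - b * y) + b * (a * y - c * x) = ?D * x"
      "c * (d * x - b * y) + d * (a * y - c * x) = ?D * y" by (simp_all add: algebra_simps)
    thus "a * ((d * x - b * y) / ?D) + b * ((a * y - c * x) / ?D) = x"
      "c * ((d * x - b * y) / ?D) + d * ((a * y - c * x) / ?D) = y"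
      using assms by (simp_all only: times_divide_eq_right add_divide_distrib[symmetric]) simp_all
  qed
  show "?g \<circ> (\<lambda>y. (a * fst y + b * snd y, c * fst y + d * snd y)) = id"
    using assms by (auto simp: fun_eq_iff 1)
  show "(\<lambda>y. (a * fst y + b * snd y, c * fst y + d * snd y)) \<circ> ?g = id"
    by (simp add: fun_eq_iff 2 del: times_divide_eq_right)
qed

section \<open>The forms and the map\<close>

text \<open>The setting of the theorem, with the relation between the forms expressed through their
  coefficient functions alone.\<close>

locale triangle_forms =
  fixes p q r :: nat and \<theta> fa fb finf :: "complex \<Rightarrow> complex" and ca cb :: complex
  assumes pq: "2 \<le> p" "p < q" "coprime p q"
    and r_def: "r = p*q - p - q"
    and theta_hol: "\<theta> holomorphic_on H2"
    and theta_inv: "\<And>g z. g \<in> Gamma p q \<Longrightarrow> z \<in> H2 \<Longrightarrow> \<theta> (mob g z) = \<theta> z"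
    and theta_surj: "\<theta> ` H2 = UNIV"
    and theta_inj: "\<And>z w. z \<in> H2 \<Longrightarrow> w \<in> H2 \<Longrightarrow> \<theta> z = \<theta> w \<Longrightarrow> (\<exists>g\<in>Gamma p q. w = mob g z)"
    and theta_apt: "\<theta> (apt p) = 0"
    and theta_bpt: "\<theta> (bpt q) = 1"
    and fa_hol: "fa holomorphic_on H2"
    and fa_eq: "\<And>z. z \<in> H2 \<Longrightarrow> \<theta> z \<noteq> 0 \<Longrightarrow> \<theta> z \<noteq> 1 \<Longrightarrow>
        fa z ^ r = deriv \<theta> z ^ q / (\<theta> z * (\<theta> z - 1) ^ (q - 1))"
    and fb_hol: "fb holomorphic_on H2"
    and fb_eq: "\<And>z. z \<in> H2 \<Longrightarrow> \<theta> z \<noteq> 0 \<Longrightarrow> \<theta> z \<noteq> 1 \<Longrightarrow>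
        fb z ^ r = deriv \<theta> z ^ p / (\<theta> z ^ (p - 1) * (\<theta> z - 1))"
    and finf_hol: "finf holomorphic_on H2"
    and finf_eq: "\<And>z. z \<in> H2 \<Longrightarrow> \<theta> z \<noteq> 0 \<Longrightarrow> \<theta> z \<noteq> 1 \<Longrightarrow>
        finf z ^ r = deriv \<theta> z ^ (p*q) / (\<theta> z ^ ((p - 1)*q) * (\<theta> z - 1) ^ (p*(q - 1)))"
    and c_nz: "ca \<noteq> 0" "cb \<noteq> 0"
    and c_rel: "\<And>z. z \<in> H2 \<Longrightarrow> finf z = ca * fa z ^ p + cb * fb z ^ q"
begin

section \<open>Arithmetic of the exponents and generic points\<close>

lemma q_ge2: "2 \<le> q" using pq by simp

lemma exponents: "r > 0" "p * q = r + p + q" "(p - 1) * q = r + p" "p * (q - 1) = r + q"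
proof -
  \<comment> \<open>The substitution p = m + 2, q = n + 3 avoids truncated subtraction and makes r =
    mn + 2m + n + 1 visibly positive.\<close>
  define m n where "m = p - 2" and "n = q - 3"
  hence mn: "p = m + 2" "q = n + 3" using pq by simp_all
  have r: "r = m * n + 2 * m + n + 1" unfolding r_def mn by (simp add: algebra_simps)
  show "r > 0" "p * q = r + p + q" "(p - 1) * q = r + p" "p * (q - 1) = r + q"
    unfolding r unfolding mn by (simp_all add: algebra_simps)
qed

text \<open>Since pq = r + p + q, a common divisor of r and one of p, q divides the other as
  well.\<close>

lemma coprime_r: "coprime p r" "coprime q r"
proof -
  have "x dvd 1" if "x dvd p" "x dvd r" for x
  proof -
    have "x dvd p * q" using that by simp
    hence "x dvd q" unfolding exponents(2) using that by (simp add: dvd_add_right_iff)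
    thus ?thesis using that pq by (meson coprime_common_divisor)
  qed
  thus "coprime p r" by (rule coprimeI)
  have "x dvd 1" if "x dvd q" "x dvd r" for x
  proof -
    have "x dvd p * q" using that by simp
    hence "x dvd r + q + p" using exponents(2) by (simp add: ac_simps)
    hence "x dvd p" using that by (simp add: dvd_add_right_iff)
    thus ?thesis using that pq by (meson coprime_common_divisor)
  qed
  thus "coprime q r" by (rule coprimeI)
qed

lemma theta_not_const: "\<not> \<theta> constant_on H2"
proof
  assume "\<theta> constant_on H2"
  then obtain c where "\<theta> ` H2 \<subseteq> {c}" unfolding constant_on_def by blast
  moreover have "c + 1 \<in> \<theta> ` H2" unfolding theta_surj by simp
  ultimately show False by auto
qed

lemma eventually_generic:
  assumes "z \<in> H2"
  shows "eventually (\<lambda>w. w \<in> H2 \<and> \<theta> w \<noteq> 0 \<and> \<theta> w \<noteq> 1) (at z)"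
proof -
  obtain b where b: "b \<in> H2" "\<theta> b = 2" using theta_surj by (metis UNIV_I imageE)
  have "(\<lambda>w. \<theta> w * (\<theta> w - 1)) holomorphic_on H2" by (intro holomorphic_intros theta_hol)
  from non_zero_neighbour_alt[OF this H2_open H2_connected assms b(1)] b(2)
  show ?thesis by (auto elim!: eventually_mono)
qed

text \<open>The equations defining the roots are given only where \<theta> avoids 0 and 1. The
  excluded points are isolated, so identities between continuous functions extend across
  them.\<close>

lemma eq_from_generic:
  fixes F G :: "complex \<Rightarrow> complex"
  assumes cont: "continuous_on H2 F" "continuous_on H2 G"
    and eq: "\<And>z. z \<in> H2 \<Longrightarrow> \<theta> z \<noteq> 0 \<Longrightarrow> \<theta> z \<noteq> 1 \<Longrightarrow> F z = G z" and z: "z \<in> H2"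
  shows "F z = G z"
proof -
  have "(F \<longlongrightarrow> F z) (at z)" "(G \<longlongrightarrow> G z) (at z)"
    using cont z H2_open by (simp_all add: continuous_on_eq_continuous_at isCont_def)
  moreover have "eventually (\<lambda>w. G w = F w) (at z)"
    using eventually_generic[OF z] by (rule eventually_mono) (auto simp: eq)
  ultimately show ?thesis using tendsto_cong[of G F "at z"] tendsto_unique[of "at z" F] by auto
qed

lemma dtheta: "deriv \<theta> holomorphic_on H2"
  using holomorphic_deriv[OF theta_hol H2_open] .

lemma cont [continuous_intros]:
  "continuous_on H2 \<theta>" "continuous_on H2 fa" "continuous_on H2 fb" "continuous_on H2 finf"
  "continuous_on H2 (deriv \<theta>)" "continuous_on H2 (deriv fa)" "continuous_on H2 (deriv fb)"
  by (intro holomorphic_on_imp_continuous_on theta_hol fa_hol fb_hol finf_hol dtheta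
      holomorphic_deriv[OF _ H2_open])+

section \<open>Ramification of \<theta> and nonvanishing of \<open>finf\<close>\<close>

lemma finf_power:
  assumes "z \<in> H2"
  shows "finf z ^ r * (\<theta> z ^ (r + p) * (\<theta> z - 1) ^ (r + q)) = deriv \<theta> z ^ (p*q)"
proof (rule eq_from_generic[where F = "\<lambda>z. finf z ^ r * (\<theta> z ^ (r + p) * (\<theta> z - 1) ^ (r + q))"
    and G = "\<lambda>z. deriv \<theta> z ^ (p*q)"])
  show "finf z ^ r * (\<theta> z ^ (r + p) * (\<theta> z - 1) ^ (r + q)) = deriv \<theta> z ^ (p*q)"
    if "z \<in> H2" "\<theta> z \<noteq> 0" "\<theta> z \<noteq> 1" for z
    using finf_eq[OF that] that exponents(3,4) by simp
qed (intro continuous_intros assms)+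

text \<open>The local rotation \<open>\<phi>\<^sup>-\<^sup>1 (\<zeta> \<phi>)\<close> preserves \<open>\<theta>\<close>, so it maps each point to one in the same orbit;
  as \<open>\<Gamma>\<close> is countable, a single group element does this on an uncountable set and hence
  everywhere. This takes the place of a proper discontinuity argument.\<close>

lemma local_rotation:
  assumes n: "n > 0" and \<rho>: "\<rho> > 0" "ball z \<rho> \<subseteq> H2" and \<phi>: "\<phi> holomorphic_on ball z \<rho>"
    "\<phi> z = 0" "inj_on \<phi> (ball z \<rho>)" "\<And>w. w \<in> ball z \<rho> \<Longrightarrow> \<theta> w - \<theta> z = \<phi> w ^ n"
    and \<zeta>: "\<zeta> ^ n = 1"
  shows "\<exists>g\<in>Gamma p q. mob g z = z \<and> dmob g z = \<zeta>"
proof -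
  let ?B = "ball z \<rho>"
  obtain \<psi> where \<psi>: "\<psi> holomorphic_on \<phi> ` ?B" "\<And>w. w \<in> ?B \<Longrightarrow> deriv \<phi> w * deriv \<psi> (\<phi> w) = 1"
    "\<And>w. w \<in> ?B \<Longrightarrow> \<psi> (\<phi> w) = w"
    using holomorphic_has_inverse[OF \<phi>(1) open_ball \<phi>(3)] by metis
  have "open (\<phi> ` ?B)" by (rule open_mapping_thm3[OF \<phi>(1) open_ball \<phi>(3)])
  moreover have "0 \<in> \<phi> ` ?B" using \<phi>(2) \<rho>(1) by (metis centre_in_ball imageI)
  ultimately obtain \<epsilon> where \<epsilon>: "\<epsilon> > 0" "ball 0 \<epsilon> \<subseteq> \<phi> ` ?B" using openE by blast
  have \<psi>in: "\<psi> t \<in> ?B" "\<phi> (\<psi> t) = t" if "t \<in> ball 0 \<epsilon>" for t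
    using that \<epsilon>(2) \<psi>(3) by auto
  have z: "z \<in> H2" using \<rho> by auto
  have \<psi>0: "\<psi> 0 = z" using \<psi>(3)[of z] \<phi>(2) \<rho>(1) by simp
  have norm\<zeta>: "norm \<zeta> = 1" using power_eq_imp_eq_norm[of \<zeta> n 1] \<zeta> n by simp
  hence rot: "\<zeta> * t \<in> ball 0 \<epsilon>" if "t \<in> ball 0 \<epsilon>" for t using that by (simp add: norm_mult)
  have hol: "\<psi> holomorphic_on ball 0 \<epsilon>" using \<psi>(1) \<epsilon>(2) holomorphic_on_subset by blast
  have "\<exists>g\<in>Gamma p q. \<forall>t\<in>ball 0 \<epsilon>. \<psi> (\<zeta> * t) = mob g (\<psi> t)"
  proof (rule holomorphic_eq_one_of_countably_many)
    show "(\<lambda>t. \<psi> (\<zeta> * t)) holomorphic_on ball 0 \<epsilon>"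
      by (rule holomorphic_on_compose_gen[OF _ hol, unfolded o_def])
        (use rot in \<open>auto intro!: holomorphic_intros\<close>)
    show "(\<lambda>t. mob g (\<psi> t)) holomorphic_on ball 0 \<epsilon>" if "g \<in> Gamma p q" for g
      by (rule holomorphic_on_compose_gen[OF hol mob_holomorphic, unfolded o_def])
        (use \<psi>in \<rho> mdet_Gamma[OF that] in auto)
    show "\<exists>g\<in>Gamma p q. \<psi> (\<zeta> * t) = mob g (\<psi> t)" if t: "t \<in> ball 0 \<epsilon>" for t
    proof (rule theta_inj)
      show "\<psi> t \<in> H2" "\<psi> (\<zeta> * t) \<in> H2" using \<psi>in(1) rot t \<rho> by blast+
      have "\<theta> (\<psi> t) - \<theta> z = t ^ n" "\<theta> (\<psi> (\<zeta> * t)) - \<theta> z = (\<zeta> * t) ^ n"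
        using \<phi>(4) \<psi>in t rot by simp_all
      hence "\<theta> (\<psi> t) - \<theta> z = \<theta> (\<psi> (\<zeta> * t)) - \<theta> z" using \<zeta> by (simp add: power_mult_distrib)
      thus "\<theta> (\<psi> t) = \<theta> (\<psi> (\<zeta> * t))" by simp
    qed
  qed (use \<epsilon> pq in \<open>auto intro: countable_Gamma\<close>)
  then obtain g where g: "g \<in> Gamma p q" and eq: "\<And>t. t \<in> ball 0 \<epsilon> \<Longrightarrow> \<psi> (\<zeta> * t) = mob g (\<psi> t)"
    by blast
  \<comment> \<open>At t = 0 the identity \<open>eq\<close> shows that g fixes z; comparing the
    derivatives of its two sides at 0 identifies the rotation as \<zeta>.\<close>
  have fixz: "mob g z = z" using eq[of 0] \<epsilon>(1) \<psi>0 by simp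
  have d: "(\<psi> has_field_derivative deriv \<psi> 0) (at 0)"
    using holomorphic_derivI[OF hol open_ball, of 0] \<epsilon>(1) by simp
  have d1: "((\<lambda>t. \<psi> (\<zeta> * t)) has_field_derivative deriv \<psi> 0 * \<zeta>) (at 0)"
    by (rule DERIV_chain2[of \<psi>]) (use d in \<open>auto intro!: derivative_eq_intros\<close>)
  have d2: "((\<lambda>t. mob g (\<psi> t)) has_field_derivative dmob g z * deriv \<psi> 0) (at 0)"
    by (rule DERIV_chain2[of "mob g"]) (use d has_field_derivative_mob[OF mdet_Gamma[OF g] z] in \<open>simp_all add: \<psi>0\<close>)
  have "((\<lambda>t. mob g (\<psi> t)) has_field_derivative deriv \<psi> 0 * \<zeta>) (at 0)"
    by (rule has_field_derivative_transform_within_open[OF d1 open_ball[of 0 \<epsilon>]]) (use \<epsilon>(1) eq in auto)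
  hence "deriv \<psi> 0 * \<zeta> = dmob g z * deriv \<psi> 0" using d2 DERIV_unique by blast
  moreover have "deriv \<psi> 0 \<noteq> 0" using \<psi>(2)[of z] \<phi>(2) \<rho>(1) by auto
  ultimately show ?thesis using g fixz by (intro bexI[of _ g]) auto
qed

text \<open>Applying the local rotation to a primitive n-th root of unity gives a nontrivial
  stabilizer element. The classification of fixed points then makes n a divisor of p over 0 or of q
  over 1.\<close>

lemma ramification_bound:
  assumes n: "n \<ge> 2" and \<rho>: "\<rho> > 0" "ball z \<rho> \<subseteq> H2" and \<phi>: "\<phi> holomorphic_on ball z \<rho>"
    "\<phi> z = 0" "inj_on \<phi> (ball z \<rho>)" "\<And>w. w \<in> ball z \<rho> \<Longrightarrow> \<theta> w - \<theta> z = \<phi> w ^ n"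
  shows "(\<theta> z = 0 \<and> n \<le> p) \<or> (\<theta> z = 1 \<and> n \<le> q)"
proof -
  define \<zeta> where "\<zeta> = exp (2 * of_real pi * \<i> * of_nat 1 / of_nat n)"
  have unity: "\<zeta> ^ k = 1 \<longleftrightarrow> n dvd k" for k
  proof -
    have "\<zeta> ^ k = exp (2 * of_real pi * \<i> * of_nat k / of_nat n)"
      unfolding \<zeta>_def by (simp flip: exp_of_nat_mult add: mult_ac)
    thus ?thesis using complex_root_unity_eq_1[of n k] n by simp
  qed
  have z: "z \<in> H2" using \<rho> by auto
  have "\<exists>g\<in>Gamma p q. mob g z = z \<and> dmob g z = \<zeta>"
    by (rule local_rotation[OF _ \<rho> \<phi>]) (use n unity[of n] in auto)
  then obtain g where g: "g \<in> Gamma p q" "mob g z = z" "dmob g z = \<zeta>" by blast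
  have "\<zeta> \<noteq> 1" using unity[of 1] n by simp
  hence "(\<exists>h\<in>Gamma p q. z = mob h (apt p) \<and> \<zeta> ^ p = 1) \<or> (\<exists>h\<in>Gamma p q. z = mob h (bpt q) \<and> \<zeta> ^ q = 1)"
    using Gamma_fixed_point[OF pq(1) q_ge2 g(1) z g(2)] g(3) by simp
  thus ?thesis using theta_inv theta_apt theta_bpt apt_bpt_in_H2 pq q_ge2 unity
    by (auto intro!: dvd_imp_le)
qed

text \<open>If \<open>\<theta>\<close> takes the value \<open>0\<close> or \<open>1\<close> with multiplicity \<open>n\<close>, comparing orders of vanishing in the
  equation for \<open>finf\<^sup>r\<close> shows that a zero of \<open>finf\<close> forces \<open>n > p\<close> or \<open>n > q\<close> respectively.\<close>

lemma local_power_nonvanishing: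
  assumes \<rho>: "\<rho> > 0" "ball z \<rho> \<subseteq> H2" and \<phi>: "\<phi> holomorphic_on ball z \<rho>"
    "\<phi> z = 0" "deriv \<phi> z \<noteq> 0" "inj_on \<phi> (ball z \<rho>)" "\<And>w. w \<in> ball z \<rho> \<Longrightarrow> \<theta> w - \<theta> z = \<phi> w ^ n"
    and n: "n > 0" and F: "continuous_on H2 F"
    and eq: "\<And>w. w \<in> ball z \<rho> \<Longrightarrow> F w * \<phi> w ^ (n * a) = deriv \<theta> w ^ b"
    and ab: "n * a \<ge> (n - 1) * b"
  shows "F z \<noteq> 0"
proof
  assume Fz: "F z = 0"
  let ?B = "ball z \<rho>"
  have nz: "\<phi> w \<noteq> 0" if "w \<in> ?B" "w \<noteq> z" for w
    using inj_onD[OF \<phi>(4), of w z] that \<phi>(2) \<rho>(1) by auto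
  have d: "deriv \<theta> w = of_nat n * \<phi> w ^ (n - 1) * deriv \<phi> w" if w: "w \<in> ?B" for w
  proof -
    have "(\<phi> has_field_derivative deriv \<phi> w) (at w)" by (rule holomorphic_derivI[OF \<phi>(1) open_ball w])
    hence "((\<lambda>w. \<theta> z + \<phi> w ^ n) has_field_derivative of_nat n * \<phi> w ^ (n - 1) * deriv \<phi> w) (at w)"
      by (auto intro!: derivative_eq_intros simp: mult_ac)
    hence "(\<theta> has_field_derivative of_nat n * \<phi> w ^ (n - 1) * deriv \<phi> w) (at w)"
      by (rule has_field_derivative_transform_within_open[OF _ open_ball[of z \<rho>]])
        (use w in \<open>auto simp flip: \<phi>(5)\<close>)
    thus ?thesis by (rule DERIV_imp_deriv)
  qed
  \<comment> \<open>The surplus order of vanishing on the left. After cancelling \<phi>^((n-1)b) the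
    right side is nonzero at z, while the left side would vanish there together with F.\<close>
  define c where "c = n * a - (n - 1) * b"
  have c: "n * a = (n - 1) * b + c" using ab by (simp add: c_def)
  let ?L = "\<lambda>w. F w * \<phi> w ^ c" and ?R = "\<lambda>w. (of_nat n * deriv \<phi> w) ^ b"
  have LR: "?L w = ?R w" if w: "w \<in> ?B" "w \<noteq> z" for w
  proof -
    have "F w * (\<phi> w ^ ((n - 1) * b) * \<phi> w ^ c) = (of_nat n * \<phi> w ^ (n - 1) * deriv \<phi> w) ^ b"
      using eq[OF w(1)] d[OF w(1)] unfolding c by (simp add: power_add)
    also have "\<dots> = \<phi> w ^ ((n - 1) * b) * ?R w"
      unfolding power_mult_distrib power_mult by (simp only: mult_ac)
    finally show ?thesis using nz[OF w] by (simp add: mult.left_commute)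
  qed
  have cont: "continuous_on ?B ?L" "continuous_on ?B ?R"
    by (intro continuous_intros continuous_on_subset[OF F \<rho>(2)] holomorphic_on_imp_continuous_on
        \<phi>(1) holomorphic_deriv[OF \<phi>(1) open_ball])+
  have "isCont ?L z" "isCont ?R z"
    using cont \<rho>(1) by (simp_all add: continuous_on_eq_continuous_at)
  hence "(?L \<longlongrightarrow> ?L z) (at z)" "(?R \<longlongrightarrow> ?R z) (at z)" by (simp_all add: isCont_def)
  moreover have "eventually (\<lambda>w. ?L w = ?R w) (at z)"
    using \<rho>(1) LR by (auto simp: eventually_at dist_commute)
  ultimately have "?L z = ?R z" using tendsto_cong[of ?L ?R "at z"] tendsto_unique[of "at z" ?R] by auto
  thus False using Fz \<phi>(3) n by simp
qed

text \<open>At a point of multiplicity n the order of \<open>finf ^ r\<close> is q(n - p) over 0,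
  p(n - q) over 1, and pq(n - 1) elsewhere. The ramification bound makes each of these at most
  0.\<close>

lemma finf_nonzero:
  assumes z: "z \<in> H2"
  shows "finf z \<noteq> 0"
proof -
  obtain n \<phi> \<rho> where n: "n > 0" and \<rho>: "\<rho> > 0" "ball z \<rho> \<subseteq> H2"
    and \<phi>: "\<phi> holomorphic_on ball z \<rho>" "\<phi> z = 0" "deriv \<phi> z \<noteq> 0" "inj_on \<phi> (ball z \<rho>)"
    "\<And>w. w \<in> ball z \<rho> \<Longrightarrow> \<theta> w - \<theta> z = \<phi> w ^ n"
    using holomorphic_local_power[OF theta_hol H2_open H2_connected theta_not_const z] by metis
  have ram: "n \<ge> 2 \<Longrightarrow> (\<theta> z = 0 \<and> n \<le> p) \<or> (\<theta> z = 1 \<and> n \<le> q)"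
    by (rule ramification_bound[OF _ \<rho> \<phi>(1,2,4,5)])
  note nonvanishing = local_power_nonvanishing[OF \<rho> \<phi> n]
  note fp = finf_power[OF subsetD[OF \<rho>(2)]]
  have le: "(n - 1) * (p * q) \<le> n * (r + p)" if "n \<le> p"
  proof -
    have "n * q \<le> p * q" using that by simp
    moreover have "n * (p * q) = n * (r + p) + n * q" using exponents(2) by (simp add: algebra_simps)
    ultimately show ?thesis unfolding diff_mult_distrib by linarith
  qed
  have le': "(n - 1) * (p * q) \<le> n * (r + q)" if "n \<le> q"
  proof -
    have "n * p \<le> p * q" using that by (simp add: mult.commute)
    moreover have "n * (p * q) = n * (r + q) + n * p" using exponents(2) by (simp add: algebra_simps)
    ultimately show ?thesis unfolding diff_mult_distrib by linarith
  qed
  consider "\<theta> z = 0" | "\<theta> z = 1" | "\<theta> z \<noteq> 0" "\<theta> z \<noteq> 1" by blast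
  thus ?thesis
  proof cases
    case 1
    have "finf z ^ r * (\<theta> z - 1) ^ (r + q) \<noteq> 0"
    proof (rule nonvanishing[of "\<lambda>z. finf z ^ r * (\<theta> z - 1) ^ (r + q)" "r + p" "p * q"])
      show "finf w ^ r * (\<theta> w - 1) ^ (r + q) * \<phi> w ^ (n * (r + p)) = deriv \<theta> w ^ (p * q)"
        if "w \<in> ball z \<rho>" for w
        using fp[OF that] \<phi>(5)[OF that] 1 by (simp add: power_mult mult_ac)
      show "(n - 1) * (p * q) \<le> n * (r + p)"
        using le ram 1 n pq by (cases "n \<ge> 2") auto
    qed (auto intro!: continuous_intros)
    thus ?thesis using exponents(1) by auto
  next
    case 2
    have "finf z ^ r * \<theta> z ^ (r + p) \<noteq> 0"
    proof (rule nonvanishing[of "\<lambda>z. finf z ^ r * \<theta> z ^ (r + p)" "r + q" "p * q"])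
      show "finf w ^ r * \<theta> w ^ (r + p) * \<phi> w ^ (n * (r + q)) = deriv \<theta> w ^ (p * q)"
        if "w \<in> ball z \<rho>" for w
        using fp[OF that] \<phi>(5)[OF that] 2 by (simp add: power_mult mult_ac)
      show "(n - 1) * (p * q) \<le> n * (r + q)"
        using le' ram 2 n pq by (cases "n \<ge> 2") auto
    qed (auto intro!: continuous_intros)
    thus ?thesis using exponents(1) by auto
  next
    case 3
    hence "n = 1" using ram n by fastforce
    \<comment> \<open>Unramified case: with n = 1 and exponent 0 the order condition reads 0 \<le>
      0, and the whole product plays the role of \<open>F\<close>.\<close>
    have "finf z ^ r * (\<theta> z ^ (r + p) * (\<theta> z - 1) ^ (r + q)) \<noteq> 0"
      by (rule nonvanishing[of "\<lambda>z. finf z ^ r * (\<theta> z ^ (r + p) * (\<theta> z - 1) ^ (r + q))" 0 "p * q"])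
        (use fp \<open>n = 1\<close> in \<open>auto intro!: continuous_intros\<close>)
    thus ?thesis using exponents(1) by auto
  qed
qed

section \<open>Relations between the three forms and the Jacobian\<close>

text \<open>The r-th powers of \<open>fa z ^ p\<close> and of \<theta> \<open>finf\<close> agree, so
  the two functions are proportional; likewise for \<open>fb z ^ q\<close> and (\<theta> - 1)
  \<open>finf\<close>. The linear relation between the forms then fixes both constants.\<close>

lemma fa_fb_relations:
  assumes "z \<in> H2"
  shows "ca * fa z ^ p = \<theta> z * finf z" and "cb * fb z ^ q = (1 - \<theta> z) * finf z"
proof -
  have ne: "H2 \<noteq> {}" using assms by blast
  have sep: "r + p = (p - 1) * q" "r + q = p * (q - 1)" using exponents by simp_all
  have a: "(fa z ^ p) ^ r = (\<theta> z * finf z) ^ r" if "z \<in> H2" for z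
  proof (rule eq_from_generic[where F = "\<lambda>z. (fa z ^ p) ^ r" and G = "\<lambda>z. (\<theta> z * finf z) ^ r"])
    show "(fa z ^ p) ^ r = (\<theta> z * finf z) ^ r" if z: "z \<in> H2" "\<theta> z \<noteq> 0" "\<theta> z \<noteq> 1" for z
    proof -
      have "(fa z ^ p) ^ r = (fa z ^ r) ^ p" by (simp only: power_mult[symmetric] mult.commute)
      also have "\<dots> = deriv \<theta> z ^ (p*q) / (\<theta> z ^ p * (\<theta> z - 1) ^ (r + q))"
        unfolding fa_eq[OF z] sep(2) by (simp add: power_divide power_mult_distrib mult.commute flip: power_mult)
      also have "\<dots> = \<theta> z ^ r * finf z ^ r"
        unfolding finf_eq[OF z] sep[symmetric] using z by (simp add: power_add field_simps)
      finally show ?thesis by (simp add: power_mult_distrib)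
    qed
  qed (intro continuous_intros that)+
  have b: "(fb z ^ q) ^ r = ((\<theta> z - 1) * finf z) ^ r" if "z \<in> H2" for z
  proof (rule eq_from_generic[where F = "\<lambda>z. (fb z ^ q) ^ r" and G = "\<lambda>z. ((\<theta> z - 1) * finf z) ^ r"])
    show "(fb z ^ q) ^ r = ((\<theta> z - 1) * finf z) ^ r" if z: "z \<in> H2" "\<theta> z \<noteq> 0" "\<theta> z \<noteq> 1" for z
    proof -
      have "(fb z ^ q) ^ r = (fb z ^ r) ^ q" by (simp only: power_mult[symmetric] mult.commute)
      also have "\<dots> = deriv \<theta> z ^ (p*q) / (\<theta> z ^ (r + p) * (\<theta> z - 1) ^ q)"
        unfolding fb_eq[OF z] sep(1) by (simp add: power_divide power_mult_distrib flip: power_mult)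
      also have "\<dots> = (\<theta> z - 1) ^ r * finf z ^ r"
        unfolding finf_eq[OF z] sep[symmetric] using z by (simp add: power_add field_simps)
      finally show ?thesis by (simp add: power_mult_distrib)
    qed
  qed (intro continuous_intros that)+
  have "\<exists>k. \<forall>z\<in>H2. fa z ^ p = k * (\<theta> z * finf z)"
    by (rule holomorphic_power_eq[OF H2_open H2_connected ne _ _ a exponents(1)])
      (intro holomorphic_intros fa_hol theta_hol finf_hol)+
  then obtain k where k: "\<And>z. z \<in> H2 \<Longrightarrow> fa z ^ p = k * (\<theta> z * finf z)" by blast
  have "\<exists>l. \<forall>z\<in>H2. fb z ^ q = l * ((\<theta> z - 1) * finf z)"
    by (rule holomorphic_power_eq[OF H2_open H2_connected ne _ _ b exponents(1)])
      (intro holomorphic_intros fb_hol theta_hol finf_hol)+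
  then obtain l where l: "\<And>z. z \<in> H2 \<Longrightarrow> fb z ^ q = l * ((\<theta> z - 1) * finf z)" by blast
  \<comment> \<open>Dividing by the nonvanishing \<open>finf\<close> leaves an affine identity in
    \<theta>. Evaluating it at the two elliptic points, where \<theta> is 0 and 1, determines
    \<open>l\<close> and \<open>k\<close>.\<close>
  have one: "1 = ca * k * \<theta> z + cb * l * (\<theta> z - 1)" if "z \<in> H2" for z
  proof -
    have "finf z * 1 = finf z * (ca * k * \<theta> z + cb * l * (\<theta> z - 1))"
      using c_rel[OF that] k[OF that] l[OF that] by (simp add: algebra_simps)
    thus ?thesis using finf_nonzero[OF that] by (simp only: mult_cancel_left) simp
  qed
  have "- (cb * l) = 1" using one[of "apt p"] theta_apt apt_bpt_in_H2 pq by simp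
  hence cl: "cb * l = - 1" by (metis minus_minus)
  have ck: "ca * k = 1" using one[of "bpt q"] theta_bpt apt_bpt_in_H2 q_ge2 by simp
  have "ca * fa z ^ p = ca * k * (\<theta> z * finf z)" using k[OF assms] by simp
  thus "ca * fa z ^ p = \<theta> z * finf z" unfolding ck by simp
  have "cb * fb z ^ q = cb * l * ((\<theta> z - 1) * finf z)" using l[OF assms] by simp
  thus "cb * fb z ^ q = (1 - \<theta> z) * finf z" unfolding cl by (simp add: algebra_simps)
qed

text \<open>The expression W on the left is a Rankin-Cohen bracket of the two forms; its degree p/r
  + q/r + 1 = pq/r is that of \<open>finf\<close>. Differentiating both relations and eliminating
  the derivative of \<open>finf\<close> gives \<theta>(\<theta> - 1) W = \<theta>' \<open>fa\<close>
  \<open>fb\<close>, whose r-th power simplifies by the defining equations.\<close>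

lemma wronskian_power:
  assumes "z \<in> H2"
  shows "(of_nat q * deriv fb z * fa z - of_nat p * fb z * deriv fa z) ^ r = finf z ^ r"
proof (rule eq_from_generic[where F = "\<lambda>z. (of_nat q * deriv fb z * fa z - of_nat p * fb z * deriv fa z) ^ r"
      and G = "\<lambda>z. finf z ^ r"])
  fix z assume z: "z \<in> H2" "\<theta> z \<noteq> 0" "\<theta> z \<noteq> 1"
  define W where "W = of_nat q * deriv fb z * fa z - of_nat p * fb z * deriv fa z"
  note D = holomorphic_derivI[OF _ H2_open z(1)]
  have "((\<lambda>z. ca * fa z ^ p) has_field_derivative ca * (of_nat p * fa z ^ (p - 1) * deriv fa z)) (at z)"
    by (auto intro!: derivative_eq_intros D[OF fa_hol])
  moreover have "((\<lambda>z. ca * fa z ^ p) has_field_derivative deriv \<theta> z * finf z + \<theta> z * deriv finf z) (at z)"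
    by (rule has_field_derivative_transform_within_open[OF _ H2_open z(1), of "\<lambda>z. \<theta> z * finf z"])
      (auto intro!: derivative_eq_intros D[OF theta_hol] D[OF finf_hol] simp: fa_fb_relations)
  ultimately have da: "ca * (of_nat p * fa z ^ (p - 1) * deriv fa z) = deriv \<theta> z * finf z + \<theta> z * deriv finf z"
    by (rule DERIV_unique)
  have "((\<lambda>z. cb * fb z ^ q) has_field_derivative cb * (of_nat q * fb z ^ (q - 1) * deriv fb z)) (at z)"
    by (auto intro!: derivative_eq_intros D[OF fb_hol])
  moreover have "((\<lambda>z. cb * fb z ^ q) has_field_derivative - deriv \<theta> z * finf z + (1 - \<theta> z) * deriv finf z) (at z)"
    by (rule has_field_derivative_transform_within_open[OF _ H2_open z(1), of "\<lambda>z. (1 - \<theta> z) * finf z"])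
      (auto intro!: derivative_eq_intros D[OF theta_hol] D[OF finf_hol] simp: fa_fb_relations)
  ultimately have db: "cb * (of_nat q * fb z ^ (q - 1) * deriv fb z) = - deriv \<theta> z * finf z + (1 - \<theta> z) * deriv finf z"
    by (rule DERIV_unique)
  have pa: "fa z ^ p = fa z ^ (p - 1) * fa z" using pq by (simp flip: power_Suc2)
  have pb: "fb z ^ q = fb z ^ (q - 1) * fb z" using q_ge2 by (simp flip: power_Suc2)
  have nz: "finf z \<noteq> 0" using finf_nonzero z by blast
  have "(\<theta> z * (1 - \<theta> z) * W) * finf z ^ 2 = (ca * fa z ^ p) * (cb * fb z ^ q) * W"
    unfolding fa_fb_relations[OF z(1)] by (simp add: power2_eq_square mult_ac)
  also have "\<dots> = fa z * fb z * ((ca * fa z ^ p) * (cb * (of_nat q * fb z ^ (q - 1) * deriv fb z))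
     - (cb * fb z ^ q) * (ca * (of_nat p * fa z ^ (p - 1) * deriv fa z)))"
    unfolding W_def pa pb by (simp add: algebra_simps)
  also have "\<dots> = - (deriv \<theta> z * fa z * fb z) * finf z ^ 2"
    unfolding da db fa_fb_relations[OF z(1)] by (simp add: algebra_simps power2_eq_square)
  finally have "\<theta> z * (1 - \<theta> z) * W = - (deriv \<theta> z * fa z * fb z)"
    using nz by (simp only: mult_cancel_right) simp
  hence "\<theta> z * (\<theta> z - 1) * W = deriv \<theta> z * fa z * fb z" by (simp add: algebra_simps)
  hence "(\<theta> z * (\<theta> z - 1) * W) ^ r = (deriv \<theta> z * fa z * fb z) ^ r" by simp
  hence "\<theta> z ^ r * (\<theta> z - 1) ^ r * W ^ r = deriv \<theta> z ^ r * fa z ^ r * fb z ^ r"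
    by (simp only: power_mult_distrib)
  also have "\<dots> = deriv \<theta> z ^ (p * q) / (\<theta> z ^ p * (\<theta> z - 1) ^ q)"
  proof -
    have t: "\<theta> z * \<theta> z ^ (p - 1) = \<theta> z ^ p" "(\<theta> z - 1) ^ (q - 1) * (\<theta> z - 1) = (\<theta> z - 1) ^ q"
      using pq by (simp_all flip: power_Suc power_Suc2)
    have "deriv \<theta> z ^ r * fa z ^ r * fb z ^ r = (deriv \<theta> z ^ r * deriv \<theta> z ^ p * deriv \<theta> z ^ q)
        / ((\<theta> z * \<theta> z ^ (p - 1)) * ((\<theta> z - 1) ^ (q - 1) * (\<theta> z - 1)))"
      unfolding fa_eq[OF z] fb_eq[OF z] by (simp add: mult_ac)
    also have "\<dots> = deriv \<theta> z ^ (p * q) / (\<theta> z ^ p * (\<theta> z - 1) ^ q)"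
      unfolding t exponents(2) power_add ..
    finally show ?thesis .
  qed
  also have "\<dots> = \<theta> z ^ r * (\<theta> z - 1) ^ r * finf z ^ r"
    unfolding finf_power[OF z(1), symmetric] using z by (simp add: power_add field_simps)
  finally show "(of_nat q * deriv fb z * fa z - of_nat p * fb z * deriv fa z) ^ r = finf z ^ r"
    using z unfolding W_def by simp
qed (intro continuous_intros assms)+

section \<open>The map and its local behaviour\<close>

text \<open>The fractional powers of the tangent vector are integer powers of the single root
  exp(u/r), so that multiplying this root by \<eta> acts with weights (p, q) on the
  coordinates.\<close>

definition \<Phi> :: "complex \<times> complex \<Rightarrow> complex \<times> complex" where
  "\<Phi> x = (fb (fst x) * exp (snd x / of_nat r) ^ p, fa (fst x) * exp (snd x / of_nat r) ^ q)"

lemma exp_div_r: "exp (u / of_nat r) ^ r = exp (u :: complex)"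
  using exponents(1) by (simp flip: exp_of_nat_mult)

text \<open>The Jacobian determinant is exp(u/r)^(p+q) / r times the bracket of
  \<open>wronskian_power\<close>, which is nonzero because \<open>finf\<close> is.\<close>

lemma loc_biholo2_Phi: "loc_biholo2 \<Phi> (H2 \<times> UNIV)"
  unfolding loc_biholo2_def
proof (intro conjI ballI)
  show "open (H2 \<times> (UNIV :: complex set))" by (intro open_Times H2_open open_UNIV)
  fix x :: "complex \<times> complex" assume x: "x \<in> H2 \<times> UNIV"
  obtain z u where zu: "x = (z,u)" "z \<in> H2" using x by auto
  have r: "of_nat r \<noteq> (0::complex)" using exponents(1) by simp
  define e where "e = exp (u / of_nat r)"
  define a b c d where "a = deriv fb z * e ^ p" and "b = fb z * (of_nat p * e ^ p / of_nat r)"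
    and "c = deriv fa z * e ^ q" and "d = fa z * (of_nat q * e ^ q / of_nat r)"
  define D where "D = (\<lambda>y. (a * fst y + b * snd y, c * fst y + d * snd y))"
  have comp: "((\<lambda>x. f (fst x) * exp (snd x / of_nat r) ^ n) has_derivative
      (\<lambda>y. deriv f z * e ^ n * fst y + f z * (of_nat n * e ^ n / of_nat r) * snd y)) (at x)"
    if f: "f holomorphic_on H2" for f n
  proof -
    have "(f has_derivative (*) (deriv f z)) (at (fst x))"
      using holomorphic_derivI[OF f H2_open zu(2)] zu(1) by (simp add: has_field_derivative_def)
    hence 1: "((\<lambda>x. f (fst x)) has_derivative (\<lambda>y. deriv f z * fst y)) (at x)"
      using has_derivative_compose[OF has_derivative_fst[OF has_derivative_ident]] by blast
    have "((\<lambda>v. exp (v / of_nat r) ^ n) has_field_derivative of_nat n * e ^ n / of_nat r) (at u)"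
      unfolding e_def exp_of_nat_mult[symmetric] using r by (auto intro!: derivative_eq_intros)
    hence "((\<lambda>v. exp (v / of_nat r) ^ n) has_derivative (*) (of_nat n * e ^ n / of_nat r)) (at (snd x))"
      using zu(1) by (simp add: has_field_derivative_def)
    hence 2: "((\<lambda>x. exp (snd x / of_nat r) ^ n) has_derivative (\<lambda>y. of_nat n * e ^ n / of_nat r * snd y)) (at x)"
      using has_derivative_compose[OF has_derivative_snd[OF has_derivative_ident]] by blast
    show ?thesis
      by (rule has_derivative_eq_rhs[OF has_derivative_mult[OF 1 2]]) (auto simp: zu(1) e_def fun_eq_iff mult_ac)
  qed
  have der: "(\<Phi> has_derivative D) (at x)"
    unfolding \<Phi>_def[abs_def] D_def a_def b_def c_def d_def
    by (intro has_derivative_Pair comp fa_hol fb_hol)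
  have "a * d - b * c = e ^ p * e ^ q / of_nat r * (of_nat q * deriv fb z * fa z - of_nat p * fb z * deriv fa z)"
    unfolding a_def b_def c_def d_def using r by (simp add: field_simps)
  moreover have "of_nat q * deriv fb z * fa z - of_nat p * fb z * deriv fa z \<noteq> 0"
    using wronskian_power[OF zu(2)] finf_nonzero[OF zu(2)] exponents(1)
    by (metis power_not_zero zero_power)
  ultimately have "a * d - b * c \<noteq> 0" using r by (simp add: e_def)
  hence "bij D" unfolding D_def by (rule bij_complex_linear2)
  moreover have "\<forall>c y. D (c * fst y, c * snd y) = (c * fst (D y), c * snd (D y))"
    by (simp add: D_def algebra_simps)
  ultimately show "\<exists>D. (\<Phi> has_derivative D) (at x)
       \<and> (\<forall>c y. D (c * fst y, c * snd y) = (c * fst (D y), c * snd (D y))) \<and> bij D"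
    using der by blast
qed

text \<open>The form \<Omega> is \<omega>\<open>\<^sub>\<infinity>\<close>. Its nonvanishing keeps
  the image off the curve V, and \<theta> is recovered from the image as the share of the second
  coordinate in \<Omega>.\<close>

lemma Phi_relations:
  assumes "z \<in> H2"
  defines "\<Omega> \<equiv> \<lambda>u. finf z * exp (u / of_nat r) ^ (p * q)"
  shows "ca * snd (\<Phi> (z,u)) ^ p = \<theta> z * \<Omega> u" "cb * fst (\<Phi> (z,u)) ^ q = (1 - \<theta> z) * \<Omega> u"
    and "cb * fst (\<Phi> (z,u)) ^ q + ca * snd (\<Phi> (z,u)) ^ p = \<Omega> u" and "\<Omega> u \<noteq> 0"
proof -
  define e where "e = exp (u / of_nat r)"
  have "ca * snd (\<Phi> (z,u)) ^ p = (ca * fa z ^ p) * e ^ (p * q)"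
    by (simp add: \<Phi>_def e_def power_mult_distrib mult.commute flip: power_mult)
  thus 1: "ca * snd (\<Phi> (z,u)) ^ p = \<theta> z * \<Omega> u"
    using fa_fb_relations[OF assms(1)] by (simp add: \<Omega>_def e_def)
  have "cb * fst (\<Phi> (z,u)) ^ q = (cb * fb z ^ q) * e ^ (p * q)"
    by (simp add: \<Phi>_def e_def power_mult_distrib flip: power_mult)
  thus 2: "cb * fst (\<Phi> (z,u)) ^ q = (1 - \<theta> z) * \<Omega> u"
    using fa_fb_relations[OF assms(1)] by (simp add: \<Omega>_def e_def)
  show "cb * fst (\<Phi> (z,u)) ^ q + ca * snd (\<Phi> (z,u)) ^ p = \<Omega> u"
    unfolding 1 2 by (simp add: algebra_simps)
  show "\<Omega> u \<noteq> 0" using finf_nonzero[OF assms(1)] by (simp add: \<Omega>_def)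
qed

text \<open>The r-th powers of the coordinates depend on u only through the tangent vector exp
  u.\<close>

lemma Phi_power: "fst (\<Phi> (z,u)) ^ r = fb z ^ r * exp u ^ p" "snd (\<Phi> (z,u)) ^ r = fa z ^ r * exp u ^ q"
proof -
  have "(exp (u / of_nat r) ^ n) ^ r = exp u ^ n" for n
    by (metis exp_div_r mult.commute power_mult)
  thus "fst (\<Phi> (z,u)) ^ r = fb z ^ r * exp u ^ p" "snd (\<Phi> (z,u)) ^ r = fa z ^ r * exp u ^ q"
    by (simp_all add: \<Phi>_def power_mult_distrib)
qed

section \<open>Orbits of \<open>Gamma\<close> and orbits of the cyclic group\<close>

text \<open>Differentiating the invariance of \<theta> gives the transformation law of its
  derivative. A branch of an r-th root may pick up a root of unity, hence the claim is about r-th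
  powers.\<close>

lemma forms_equivariant:
  assumes g: "g \<in> Gamma p q" and z: "z \<in> H2"
  shows "fa (mob g z) ^ r * dmob g z ^ q = fa z ^ r" "fb (mob g z) ^ r * dmob g z ^ p = fb z ^ r"
proof -
  note det = mdet_Gamma[OF g]
  have d: "deriv \<theta> z = deriv \<theta> (mob g z) * dmob g z" if "z \<in> H2" for z
  proof -
    have gz: "mob g z \<in> H2" using mob_in_H2 det that by blast
    have "((\<lambda>z. \<theta> (mob g z)) has_field_derivative deriv \<theta> (mob g z) * dmob g z) (at z)"
      by (rule DERIV_chain2[OF holomorphic_derivI[OF theta_hol H2_open gz] has_field_derivative_mob[OF det that]])
    hence "(\<theta> has_field_derivative deriv \<theta> (mob g z) * dmob g z) (at z)"
      by (rule has_field_derivative_transform_within_open[OF _ H2_open that]) (simp add: theta_inv g)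
    thus ?thesis by (rule DERIV_imp_deriv)
  qed
  have cmob: "continuous_on H2 (mob g)" using mob_holomorphic[OF det] by (rule holomorphic_on_imp_continuous_on)
  have "deriv (mob g) holomorphic_on H2" by (rule holomorphic_deriv[OF mob_holomorphic[OF det] H2_open])
  hence "dmob g holomorphic_on H2"
    by (rule holomorphic_transform) (simp add: DERIV_imp_deriv has_field_derivative_mob det)
  hence cd: "continuous_on H2 (dmob g)" by (rule holomorphic_on_imp_continuous_on)
  have img: "mob g ` H2 \<subseteq> H2" using mob_in_H2 det by blast
  note cc = continuous_on_compose2[OF _ cmob img]
  show "fa (mob g z) ^ r * dmob g z ^ q = fa z ^ r"
  proof (rule eq_from_generic[where F = "\<lambda>z. fa (mob g z) ^ r * dmob g z ^ q" and G = "\<lambda>z. fa z ^ r"])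
    fix z assume z: "z \<in> H2" "\<theta> z \<noteq> 0" "\<theta> z \<noteq> 1"
    have "mob g z \<in> H2" "\<theta> (mob g z) = \<theta> z" using img theta_inv[OF g] z by auto
    thus "fa (mob g z) ^ r * dmob g z ^ q = fa z ^ r"
      using z by (simp add: fa_eq d[OF z(1)] power_mult_distrib)
  qed (intro continuous_intros cc cd z)+
  show "fb (mob g z) ^ r * dmob g z ^ p = fb z ^ r"
  proof (rule eq_from_generic[where F = "\<lambda>z. fb (mob g z) ^ r * dmob g z ^ p" and G = "\<lambda>z. fb z ^ r"])
    fix z assume z: "z \<in> H2" "\<theta> z \<noteq> 0" "\<theta> z \<noteq> 1"
    have "mob g z \<in> H2" "\<theta> (mob g z) = \<theta> z" using img theta_inv[OF g] z by auto
    thus "fb (mob g z) ^ r * dmob g z ^ p = fb z ^ r"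
      using z by (simp add: fb_eq d[OF z(1)] power_mult_distrib)
  qed (intro continuous_intros cc cd z)+
qed

text \<open>Equivariance matches the r-th powers of the coordinates, and invariance of \<theta>
  matches the ratio of X^q to Y^p; \<open>common_root_of_unity\<close> combines the two.\<close>

lemma tan_equiv_imp_h_equiv:
  assumes z: "z \<in> H2" and t: "tan_equiv p q (z, exp u) (z', exp u')"
  shows "h_equiv p q (\<Phi> (z,u)) (\<Phi> (z',u'))"
proof -
  obtain g where g: "g \<in> Gamma p q" "exp u' = dmob g z * exp u" "z' = mob g z"
    using t unfolding tan_equiv_def by auto
  have z': "z' \<in> H2" unfolding g using mob_in_H2 mdet_Gamma g(1) z by blast
  have \<theta>: "\<theta> z' = \<theta> z" unfolding g using theta_inv g(1) z by blast
  let ?X = "fst (\<Phi> (z,u))" and ?Y = "snd (\<Phi> (z,u))" and ?X' = "fst (\<Phi> (z',u'))" and ?Y' = "snd (\<Phi> (z',u'))"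
  have "?X' ^ r = ?X ^ r" "?Y' ^ r = ?Y ^ r"
    unfolding Phi_power forms_equivariant[OF g(1) z, symmetric] g(2,3) by (simp_all add: power_mult_distrib)
  moreover have "?X' ^ q * ?Y ^ p = ?X ^ q * ?Y' ^ p"
  proof -
    have "(cb * ?X' ^ q) * (ca * ?Y ^ p) = (cb * ?X ^ q) * (ca * ?Y' ^ p)"
      unfolding Phi_relations[OF z] Phi_relations[OF z'] \<theta> by simp
    hence "(ca * cb) * (?X' ^ q * ?Y ^ p) = (ca * cb) * (?X ^ q * ?Y' ^ p)" by (simp add: mult_ac)
    thus ?thesis using c_nz by simp
  qed
  ultimately have "\<exists>\<eta>. \<eta> ^ r = 1 \<and> ?X' = \<eta> ^ p * ?X \<and> ?Y' = \<eta> ^ q * ?Y"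
    by (intro common_root_of_unity coprime_r exponents(1)) (use pq in auto)
  thus ?thesis using h_equiv_iff[OF r_def exponents(1)] by simp
qed

text \<open>Powers of g realize every n-th root of unity as a derivative at c. Since z lies in the
  orbit of c, conjugation transports them to z.\<close>

lemma stabilizer_element:
  assumes g: "g \<in> Gamma p q" and c: "c \<in> H2" "mob g c = c" "dmob g c = cis (2 * pi / real n)"
    and n: "n > 0" and z: "z \<in> H2" "\<theta> z = \<theta> c" and \<xi>: "\<xi> ^ n = 1"
  shows "\<exists>g\<in>Gamma p q. mob g z = z \<and> dmob g z = \<xi>"
proof -
  obtain k where "\<xi> = cis (2 * pi * real k / real n)"
    using Complex.bij_betw_roots_unity[OF n] \<xi> by (auto simp: bij_betw_def)
  hence k: "\<xi> = dmob g c ^ k" unfolding c(3) by (simp add: Complex.DeMoivre mult_ac)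
  obtain h where h: "h \<in> Gamma p q" "z = mob h c" using theta_inj[OF c(1) z(1)] z(2) by auto
  have gk: "mpow g k \<in> Gamma p q" by (rule Gamma_mpow[OF g])
  have hi: "minv h \<in> Gamma p q" by (rule Gamma_minv[OF h(1)])
  note det = mdet_Gamma[OF h(1)] mdet_Gamma[OF gk] mdet_Gamma[OF hi] mdet_Gamma[OF g]
  have hz: "mob (minv h) z = c" unfolding h(2) using mob_minv(2) det c by blast
  note fixed = mpow_fixed[OF det(4) c(1,2), of k]
  have "mob (mmul h (mmul (mpow g k) (minv h))) z = z"
    using det z(1) c(1) by (simp add: mob_mmul mdet_mmul hz fixed h(2)[symmetric])
  moreover have "dmob (mmul h (mmul (mpow g k) (minv h))) z = \<xi>"
    using det z(1) c(1) mob_minv(3)[OF det(1) z(1)]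
    by (simp add: mob_mmul mdet_mmul hz fixed k mult_ac)
  ultimately show ?thesis using Gamma_mmul h(1) gk hi by blast
qed

text \<open>First \<theta> is seen to agree at the two base points, so some g carries one to the
  other; the tangent vectors then differ by a root of unity that the stabilizer of z' can
  absorb.\<close>

lemma h_equiv_imp_tan_equiv:
  assumes z: "z \<in> H2" and z': "z' \<in> H2" and he: "h_equiv p q (\<Phi> (z,u)) (\<Phi> (z',u'))"
  shows "tan_equiv p q (z, exp u) (z', exp u')"
proof -
  let ?X = "fst (\<Phi> (z,u))" and ?Y = "snd (\<Phi> (z,u))" and ?X' = "fst (\<Phi> (z',u'))" and ?Y' = "snd (\<Phi> (z',u'))"
  obtain \<eta> where \<eta>: "\<eta> ^ r = 1" "?X' = \<eta> ^ p * ?X" "?Y' = \<eta> ^ q * ?Y"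
    using he h_equiv_iff[OF r_def exponents(1)] by auto
  define \<Omega> \<Omega>' where "\<Omega> = cb * ?X ^ q + ca * ?Y ^ p" and "\<Omega>' = cb * ?X' ^ q + ca * ?Y' ^ p"
  have c: "(\<eta> ^ q) ^ p = (\<eta> ^ p) ^ q" by (simp only: power_mult[symmetric] mult.commute)
  \<comment> \<open>Both \<Omega> and Y^p scale by \<eta>^(pq), so their quotient, and with it
    \<theta>, is unchanged.\<close>
  have \<Omega>': "\<Omega>' = (\<eta> ^ p) ^ q * \<Omega>" unfolding \<Omega>_def \<Omega>'_def \<eta>(2,3) power_mult_distrib c by (simp add: algebra_simps)
  have "ca * ?Y' ^ p = (\<eta> ^ p) ^ q * (ca * ?Y ^ p)" unfolding \<eta>(3) power_mult_distrib c by simp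
  moreover have "ca * ?Y ^ p = \<theta> z * \<Omega>" unfolding \<Omega>_def Phi_relations(3)[OF z] by (rule Phi_relations(1)[OF z])
  moreover have "ca * ?Y' ^ p = \<theta> z' * \<Omega>'" unfolding \<Omega>'_def Phi_relations(3)[OF z'] by (rule Phi_relations(1)[OF z'])
  ultimately have "\<theta> z' * \<Omega>' = \<theta> z * \<Omega>'" unfolding \<Omega>' by simp
  moreover have "\<Omega>' \<noteq> 0" unfolding \<Omega>'_def Phi_relations(3)[OF z'] by (rule Phi_relations(4)[OF z'])
  ultimately have \<theta>: "\<theta> z' = \<theta> z" by simp
  then obtain g where g: "g \<in> Gamma p q" "z' = mob g z" using theta_inj[OF z z'] by auto
  note det = mdet_Gamma[OF g(1)]
  define v where "v = dmob g z * exp u"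
  have vnz: "v \<noteq> 0" using dmob_nz[OF det z] by (simp add: v_def)
  \<comment> \<open>The discrepancy left after moving the base point by g. Comparing r-th powers of
    coordinates makes it a p-th root of unity where \<open>fb\<close> is nonzero and a q-th root
    where \<open>fa\<close> is; where both hold it is 1.\<close>
  define \<xi> where "\<xi> = exp u' / v"
  have "?X' ^ r = ?X ^ r" "?Y' ^ r = ?Y ^ r"
  proof -
    have "(\<eta> ^ n) ^ r = 1" for n using \<eta>(1) by (metis mult.commute power_mult power_one)
    thus "?X' ^ r = ?X ^ r" "?Y' ^ r = ?Y ^ r" unfolding \<eta>(2,3) by (simp_all add: power_mult_distrib)
  qed
  hence X: "fb z' ^ r * exp u' ^ p = fb z' ^ r * v ^ p" and Y: "fa z' ^ r * exp u' ^ q = fa z' ^ r * v ^ q"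
    unfolding Phi_power forms_equivariant[OF g(1) z, symmetric] g(2)[symmetric] v_def
    by (simp_all add: power_mult_distrib)
  have \<xi>p: "\<xi> ^ p = 1" if "\<theta> z' \<noteq> 1"
  proof -
    have "fb z' \<noteq> 0" using fa_fb_relations(2)[OF z'] finf_nonzero[OF z'] that q_ge2 by (auto simp: zero_power)
    thus ?thesis using X vnz by (simp add: \<xi>_def power_divide)
  qed
  have \<xi>q: "\<xi> ^ q = 1" if "\<theta> z' \<noteq> 0"
  proof -
    have "fa z' \<noteq> 0" using fa_fb_relations(1)[OF z'] finf_nonzero[OF z'] that pq by (auto simp: zero_power)
    thus ?thesis using Y vnz by (simp add: \<xi>_def power_divide)
  qed
  have "\<exists>g\<in>Gamma p q. mob g z' = z' \<and> dmob g z' = \<xi>"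
  proof -
    consider "\<theta> z' = 0" | "\<theta> z' = 1" | "\<theta> z' \<noteq> 0" "\<theta> z' \<noteq> 1" by blast
    thus ?thesis
    proof cases
      case 1
      thus ?thesis using pq z' \<xi>p theta_apt
        by (intro stabilizer_element[of "A0 p" "apt p" p]) (auto simp: Gamma_gen A0_apt apt_bpt_in_H2)
    next
      case 2
      thus ?thesis using q_ge2 z' \<xi>q theta_bpt
        by (intro stabilizer_element[of "B0 q" "bpt q" q]) (auto simp: Gamma_gen B0_bpt apt_bpt_in_H2)
    next
      case 3
      hence "\<xi> = 1" using coprime_roots_unity[OF pq(3)] \<xi>p \<xi>q pq by simp
      thus ?thesis by (intro bexI[of _ mone]) (simp_all add: Gamma.one)
    qed
  qed
  then obtain k where k: "k \<in> Gamma p q" "mob k z' = z'" "dmob k z' = \<xi>" by blast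
  have "mob (mmul k g) z = z'" "dmob (mmul k g) z * exp u = exp u'"
    using mob_mmul[OF mdet_Gamma[OF k(1)] det z] k(2,3) vnz
    by (simp_all add: g(2)[symmetric] \<xi>_def v_def)
  thus ?thesis unfolding tan_equiv_def using Gamma_mmul[OF k(1) g(1)] by (intro bexI[of _ "mmul k g"]) auto
qed

section \<open>Surjectivity and equivariance under scalars\<close>

text \<open>Surjectivity of \<theta> supplies the base point with the right ratio, and a logarithm
  supplies u with the right \<Omega>. The coordinates are then correct up to a q-th and a p-th root
  of unity.\<close>

lemma Phi_surj:
  assumes "cb * fst w ^ q + ca * snd w ^ p \<noteq> 0"
  shows "\<exists>z\<in>H2. \<exists>u. \<Phi> (z,u) = w"
proof -
  define \<Omega> where "\<Omega> = cb * fst w ^ q + ca * snd w ^ p"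
  have \<Omega>: "\<Omega> \<noteq> 0" using assms by (simp add: \<Omega>_def)
  obtain z where z: "z \<in> H2" "\<theta> z = ca * snd w ^ p / \<Omega>" using theta_surj by (metis UNIV_I imageE)
  have pqr: "of_nat (p * q) \<noteq> (0::complex)" "of_nat r \<noteq> (0::complex)" using pq exponents(1) by auto
  \<comment> \<open>Solves \<open>finf z * exp (u / r) ^ (p * q) = \<Omega>\<close>.\<close>
  define u where "u = Ln (\<Omega> / finf z) * of_nat r / of_nat (p * q)"
  define e where "e = exp (u / of_nat r)"
  have "e ^ (p * q) = exp (Ln (\<Omega> / finf z))"
    unfolding e_def u_def using pqr by (simp flip: exp_of_nat_mult)
  hence e: "finf z * e ^ (p * q) = \<Omega>" using \<Omega> finf_nonzero[OF z(1)] by simp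
  have "ca * snd (\<Phi> (z,u)) ^ p = ca * snd w ^ p"
    using Phi_relations(1)[OF z(1), of u] e \<Omega> z(2) by (simp add: e_def)
  hence Y: "snd (\<Phi> (z,u)) ^ p = snd w ^ p" using c_nz by simp
  have "cb * fst (\<Phi> (z,u)) ^ q = cb * fst w ^ q"
    using Phi_relations(3)[OF z(1), of u] e Y unfolding \<Omega>_def e_def by simp
  hence X: "fst (\<Phi> (z,u)) ^ q = fst w ^ q" using c_nz by simp
  have ratio: "\<exists>\<xi>. \<xi> ^ n = 1 \<and> y = \<xi> * x" if "x ^ n = y ^ n" "n > 0" for x y :: complex and n
  proof (cases "x = 0")
    case True
    thus ?thesis using that by (intro exI[of _ 1]) (auto simp: zero_power)
  next
    case False
    thus ?thesis using that by (intro exI[of _ "y / x"]) (simp add: power_divide flip: that(1))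
  qed
  obtain \<xi> where \<xi>: "\<xi> ^ q = 1" "fst w = \<xi> * fst (\<Phi> (z,u))" using ratio[OF X] pq by auto
  obtain \<zeta> where \<zeta>: "\<zeta> ^ p = 1" "snd w = \<zeta> * snd (\<Phi> (z,u))" using ratio[OF Y] pq by auto
  obtain s where s: "(\<xi> ^ s) ^ p = \<xi>" using coprime_power_inverse[OF pq(3)] pq \<xi> by auto
  obtain t where t: "(\<zeta> ^ t) ^ q = \<zeta>"
    using coprime_power_inverse[of q p] pq \<zeta> by (auto simp: coprime_commute)
  \<comment> \<open>By coprimality one number has p-th power \<xi> and q-th power \<zeta>. Adding r
    \<open>Ln \<sigma>\<close> to u multiplies exp(u/r) by it and so corrects both coordinates at
    once.\<close>
  define \<sigma> where "\<sigma> = \<xi> ^ s * \<zeta> ^ t"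
  have "(\<xi> ^ s) ^ q = 1" "(\<zeta> ^ t) ^ p = 1" using \<xi>(1) \<zeta>(1) by (metis mult.commute power_mult power_one)+
  hence \<sigma>: "\<sigma> ^ p = \<xi>" "\<sigma> ^ q = \<zeta>" using s t by (simp_all add: \<sigma>_def power_mult_distrib)
  have "\<sigma> \<noteq> 0" using \<sigma>(1) \<xi>(1) pq by (auto simp: zero_power)
  define v where "v = u + of_nat r * Ln \<sigma>"
  have "exp (v / of_nat r) = e * \<sigma>"
    using pqr \<open>\<sigma> \<noteq> 0\<close> by (simp add: v_def e_def add_divide_distrib exp_add)
  hence "\<Phi> (z,v) = (\<sigma> ^ p * fst (\<Phi> (z,u)), \<sigma> ^ q * snd (\<Phi> (z,u)))"
    by (simp add: \<Phi>_def e_def power_mult_distrib mult_ac)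
  also have "\<dots> = w" unfolding \<sigma> using \<xi>(2) \<zeta>(2) by (simp add: prod_eq_iff)
  finally show ?thesis using z(1) by blast
qed

text \<open>Both exp(u'/r) and \<mu> exp(u/r) are r-th roots of exp u', so they differ by an r-th
  root of unity \<eta>.\<close>

lemma Phi_equivariant:
  assumes lam: "lam \<noteq> 0" "\<mu> ^ r = lam" and u: "exp u' = lam * exp u"
  shows "h_equiv p q (\<Phi> (z,u')) (\<mu> ^ p * fst (\<Phi> (z,u)), \<mu> ^ q * snd (\<Phi> (z,u)))"
proof -
  define \<eta> where "\<eta> = \<mu> * exp (u / of_nat r) / exp (u' / of_nat r)"
  have "\<eta> ^ r = 1" using lam u by (simp add: \<eta>_def power_divide power_mult_distrib exp_div_r)
  moreover have "\<eta> * exp (u' / of_nat r) = \<mu> * exp (u / of_nat r)" by (simp add: \<eta>_def)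
  hence "\<eta> ^ n * exp (u' / of_nat r) ^ n = \<mu> ^ n * exp (u / of_nat r) ^ n" for n
    by (metis power_mult_distrib)
  hence "\<mu> ^ p * fst (\<Phi> (z,u)) = \<eta> ^ p * fst (\<Phi> (z,u'))" "\<mu> ^ q * snd (\<Phi> (z,u)) = \<eta> ^ q * snd (\<Phi> (z,u'))"
    by (simp_all add: \<Phi>_def mult.left_commute)
  ultimately show ?thesis using h_equiv_iff[OF r_def exponents(1)] by auto
qed

end

section \<open>The induced map between the quotients\<close>

text \<open>The map is given on the universal cover of the fibres, where (z, u) stands for the
  tangent vector exp u at z. The two implications between \<open>tan_equiv\<close> and
  \<open>h_equiv\<close> say that it descends to a well-defined injective map on orbits.\<close>

theorem mainTheorem3:
  fixes p q r :: nat
    and \<theta> fa fb finf :: "complex \<Rightarrow> complex"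
    and ca cb :: complex
  assumes pq: "2 \<le> p" "p < q" "coprime p q"
    and r_def: "r = p*q - p - q"
    and theta_hol: "\<theta> holomorphic_on H2"
    and theta_inv: "\<And>g z. g \<in> Gamma p q \<Longrightarrow> z \<in> H2 \<Longrightarrow> \<theta> (mob g z) = \<theta> z"
    and theta_surj: "\<theta> ` H2 = UNIV"
    and theta_inj: "\<And>z w. z \<in> H2 \<Longrightarrow> w \<in> H2 \<Longrightarrow> \<theta> z = \<theta> w \<Longrightarrow>
                       (\<exists>g\<in>Gamma p q. w = mob g z)"
    and theta_a: "\<theta> (Complex (- cos (pi / real p)) (sin (pi / real p))) = 0"
    and theta_b: "\<theta> (Complex (cos (pi / real q)) (sin (pi / real q))) = 1"
    and fa_hol: "fa holomorphic_on H2"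
    and fa_eq: "\<And>z. z \<in> H2 \<Longrightarrow> \<theta> z \<noteq> 0 \<Longrightarrow> \<theta> z \<noteq> 1 \<Longrightarrow>
        fa z ^ r = deriv \<theta> z ^ q / (\<theta> z * (\<theta> z - 1) ^ (q - 1))"
    and fb_hol: "fb holomorphic_on H2"
    and fb_eq: "\<And>z. z \<in> H2 \<Longrightarrow> \<theta> z \<noteq> 0 \<Longrightarrow> \<theta> z \<noteq> 1 \<Longrightarrow>
        fb z ^ r = deriv \<theta> z ^ p / (\<theta> z ^ (p - 1) * (\<theta> z - 1))"
    and finf_hol: "finf holomorphic_on H2"
    and finf_eq: "\<And>z. z \<in> H2 \<Longrightarrow> \<theta> z \<noteq> 0 \<Longrightarrow> \<theta> z \<noteq> 1 \<Longrightarrow>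
        finf z ^ r = deriv \<theta> z ^ (p*q) / (\<theta> z ^ ((p - 1)*q) * (\<theta> z - 1) ^ (p*(q - 1)))"
    and c_nz: "ca \<noteq> 0" "cb \<noteq> 0"
    and c_rel: "\<And>z u. z \<in> H2 \<Longrightarrow>
        form finf (real (p*q) / real r) (z,u)
        = ca * (form fa (real q / real r) (z,u)) ^ p + cb * (form fb (real p / real r) (z,u)) ^ q"
  shows "\<exists>\<Phi> :: complex \<times> complex \<Rightarrow> complex \<times> complex.
     loc_biholo2 \<Phi> (H2 \<times> UNIV)
     \<and> (\<forall>z\<in>H2. \<forall>u. cb * fst (\<Phi> (z,u)) ^ q + ca * snd (\<Phi> (z,u)) ^ p \<noteq> 0)
     \<and> (\<forall>z\<in>H2. \<forall>u. \<forall>z'\<in>H2. \<forall>u'.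
          tan_equiv p q (z, exp u) (z', exp u') \<longrightarrow> h_equiv p q (\<Phi> (z,u)) (\<Phi> (z',u')))
     \<and> (\<forall>z\<in>H2. \<forall>u. \<forall>z'\<in>H2. \<forall>u'.
          h_equiv p q (\<Phi> (z,u)) (\<Phi> (z',u')) \<longrightarrow> tan_equiv p q (z, exp u) (z', exp u'))
     \<and> (\<forall>w. cb * fst w ^ q + ca * snd w ^ p \<noteq> 0 \<longrightarrow>
          (\<exists>z\<in>H2. \<exists>u. h_equiv p q (\<Phi> (z,u)) w))
     \<and> (\<forall>lam \<mu> :: complex. lam \<noteq> 0 \<longrightarrow> \<mu> ^ r = lam \<longrightarrow>
          (\<forall>z\<in>H2. \<forall>u u'. exp u' = lam * exp u \<longrightarrow>
             h_equiv p q (\<Phi> (z,u')) (\<mu> ^ p * fst (\<Phi> (z,u)), \<mu> ^ q * snd (\<Phi> (z,u)))))"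
proof -
  interpret triangle_forms p q r \<theta> fa fb finf ca cb
  proof
    \<comment> \<open>At u = 0 all exponential factors of the forms equal 1.\<close>
    show "finf z = ca * fa z ^ p + cb * fb z ^ q" if "z \<in> H2" for z
      using c_rel[OF that, of 0] by (simp add: form_def)
  qed (use assms in \<open>auto simp: apt_def bpt_def\<close>)
  show ?thesis
  proof (intro exI[of _ \<Phi>] conjI allI ballI impI)
    show "\<exists>z\<in>H2. \<exists>u. h_equiv p q (\<Phi> (z,u)) w" if "cb * fst w ^ q + ca * snd w ^ p \<noteq> 0" for w
    proof -
      have "h_equiv p q w w" using h_equiv_iff[OF r_def exponents(1)] by (auto intro: exI[of _ 1])
      thus ?thesis using Phi_surj[OF that] by metis
    qed
    show "cb * fst (\<Phi> (z,u)) ^ q + ca * snd (\<Phi> (z,u)) ^ p \<noteq> 0" if "z \<in> H2" for z u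
      using Phi_relations(3,4)[OF that] by metis
  qed (use loc_biholo2_Phi tan_equiv_imp_h_equiv h_equiv_imp_tan_equiv Phi_equivariant in blast)+
qed

end
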